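(* Let $f:\mathbb{R}^n\to\mathbb{R}$ be convex and three times differentiable with $\|D^3f(x)-D^3f(y)\|\le L_f\|x-y\|$ for all $x,y\in\mathbb{R}^n$, let $\psi:\mathbb{R}^n\to\mathbb{R}\cup\{+\infty\}$ be convex, and let $\tilde f=f+\psi$ have a minimizer $x^*$. Let $x_0\in\mathrm{dom}\,\psi$, suppose that $\max\{\|x-x^*\| : \tilde f(x)\le\tilde f(x_0)\}\le R_0$ with $R_0\in(0,+\infty)$, and suppose that $\|g\|\le L_\psi$ for all $z\in\mathrm{dom}\,\psi$ and all $g\in\partial\psi(z)$. Then, to generate an $\epsilon$-approximate minimizer of $\tilde f$, in the sense of a point $\bar x$ with $$\min\{\|\nabla\tilde f(\bar x)\|,\ \tilde f(\bar x)-\tilde f(x^* )\}\le\epsilon,$$ Algorithm 3 (described in the context) needs at most $\mathcal{O}(|\log_{1.2}(\epsilon)|\,\epsilon^{-1/4})$ iterations of Algorithm 1 in total. That is, there exist $C>0$ and $\epsilon_0\in(0,1)$, depending only on $n$, $L_f$, $M_0$, $R_0$, $L_\psi$, $\mathrm{trace}(\nabla^2f(x_0))$, $\|\nabla^2f(x_0)\|$ and $\|D^3f(x_0)\|$, such that for every $\epsilon\in(0,\epsilon_0]$ Algorithm 3 run with accuracy $\epsilon$ generates such a trial point $\bar x$, and the total number of iterations of Algorithm 1 (over all its executions) up to the generation of the first such $\bar x$ is at most $C\,|\log_{1.2}(\epsilon)|\,\epsilon^{-1/4}$.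
   Context: $\|\cdot\|$ is the Euclidean norm on $\mathbb{R}^n$ and the induced norm on matrices and tensors. $\partial$ denotes the convex subdifferential; $\partial\tilde f(x)=\nabla f(x)+\partial\psi(x)$, and $\nabla\tilde f(x)$ denotes a chosen element of $\partial\tilde f(x)$. Models. $\Phi_x(y)=f(x)+\sum_{i=1}^3\frac1{i!}D^if(x)[y-x]^i$; for $M>0$, $\Omega_{x,M}(y)=\Phi_x(y)+\frac M8\|y-x\|^4$ and $\tilde\Omega_{x,M}=\Omega_{x,M}+\psi$. Also $\rho_x(y)=\frac12\langle\nabla^2f(x)(y-x),y-x\rangle+\frac M8\|y-x\|^4$ and $\beta_{\rho_x}(u,v)=\rho_x(v)-\rho_x(u)-\langle\nabla\rho_x(u),v-u\rangle$. All minimizers required by the algorithms are assumed to exist. Algorithm 1 (inner solver for approximately minimizing $\tilde\Omega_{x,M}$). Input: $x\in\mathrm{dom}\,\psi$, $\nabla\tilde f(x)\in\partial\tilde f(x)$, $M,\epsilon>0$. Step 0: set $L_{x,M}=\mathrm{trace}(\nabla^2f(x))+\frac{3M}2\left[\frac{96\|\nabla\tilde f(x)\|}{M}\right]^{2/3}$, $\beta_{x,M}=\frac12\mathrm{trace}(\nabla^2f(x))\left[\frac{96\|\nabla\tilde f(x)\|}{M}\right]^{2/3}+\frac M8\left[\frac{96\|\nabla\tilde f(x)\|}{M}\right]^{4/3}$, $y_0=x$, $\alpha=0$, $k=0$. Step 1: compute $y_{k+1}=\arg\min_{y}\{\langle\nabla\Omega_{x,M}(y_k),y-y_k\rangle+3\beta_{\rho_x}(y_k,y)+\psi(y)\}$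 and $g_\psi(y_{k+1})=-\nabla\Omega_{x,M}(y_k)+3[\nabla\rho_x(y_k)-\nabla\rho_x(y_{k+1})]$, which belongs to $\partial\psi(y_{k+1})$. Step 2: if $\|\nabla\Omega_{x,M}(y_{k+1})+g_\psi(y_{k+1})\|\le\epsilon/7$ or $\|\nabla\Omega_{x,M}(y_{k+1})+g_\psi(y_{k+1})\|\le\frac M6\|y_{k+1}-x\|^3$, set $x^+=y_{k+1}$ and stop. Step 3: if $\|\nabla\Omega_{x,M}(y_{k+1})+g_\psi(y_{k+1})\|^4>\frac{3^8L_{x,M}^4\beta_{x,M}}{2M(6/5)^k}$, set $x^+=y_{k+1}$, $\alpha=1$ and stop. Step 4: set $k:=k+1$ and go to Step 1. Output: $(x^+,\alpha)$, together with $g_\psi(x^+)$. An iteration of Algorithm 1 is one computation of a point $y_{k+1}$. Algorithm 3. Step 0: choose $x_0\in\mathrm{dom}\,\psi$, $M_0,\epsilon>0$, define $\varphi_0(x)=\frac14\|x-x_0\|^4$ on $\mathrm{dom}\,\psi$; set $v_0=x_0$, $A_0=0$, $t=0$. Step 1: let $i$ be the smallest integer $\ge0$ with $2^iM_t\ge2M_0$. Step 1.1: compute $a_{t,i}>0$ solving $a_{t,i}^4=\frac{4^2(A_t+a_{t,i})^3}{18^3(2^iM_t)}$. Step 1.2: set $\gamma_{t,i}=\frac{a_{t,i}}{A_t+a_{t,i}}$ and $z_{t,i}=(1-\gamma_{t,i})x_t+\gamma_{t,i}v_t$. Step 1.3: apply Algorithm 1 with $x=z_{t,i}$ (and some $\nabla\tilde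 f(z_{t,i})\in\partial\tilde f(z_{t,i})$), $M=2^iM_t$ and the same $\epsilon$; let $(x^+_{t,i},\alpha_{t,i})$ be its output and $\nabla\tilde f(x^+_{t,i})=\nabla f(x^+_{t,i})+g_\psi(x^+_{t,i})$. Step 1.4: if $\alpha_{t,i}=1$, set $i:=i+1$ and go to Step 1.1. Step 1.5: if $\|\nabla\tilde f(x^+_{t,i})\|\le\epsilon$, set $x_{t+1}=x^+_{t,i}$ and stop. Step 1.6: if $\langle\nabla\tilde f(x^+_{t,i}),z_{t,i}-x^+_{t,i}\rangle\ge\frac{1}{6(2^iM_t)^{1/3}}\|\nabla\tilde f(x^+_{t,i})\|^{4/3}$, set $i_t=i$ and go to Step 2; otherwise set $i:=i+1$ and go to Step 1.1. Step 2: set $x_{t+1}=x^+_{t,i_t}$, $z_t=z_{t,i_t}$, $a_t=a_{t,i_t}$, $\gamma_t=\gamma_{t,i_t}$, $A_{t+1}=A_t+a_t$, $M_{t+1}=2^{i_t-1}M_t$. Step 3: define $\varphi_{t+1}(x)=\varphi_t(x)+a_t[f(x_{t+1})+\langle\nabla f(x_{t+1}),x-x_{t+1}\rangle+\psi(x)]$ on $\mathrm{dom}\,\psi$ and compute $v_{t+1}=\arg\min_{x\in\mathrm{dom}\,\psi}\varphi_{t+1}(x)$. Step 4: set $t:=t+1$ and go to Step 1. A trial point is any point $x^+_{t,i}$. *)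

theory Defs
  imports "HOL-Analysis.Analysis"
begin

subsection \<open>Derivatives\<close>

text \<open>The tensors \<open>D\<^sup>i f(x)\<close> are iterated Frechet derivatives; the norm of the nested type
  of bounded linear maps is the norm on multilinear forms induced by the Euclidean norm.\<close>

definition fderiv ::
  "('a::euclidean_space \<Rightarrow> 'b::real_normed_vector) \<Rightarrow> 'a \<Rightarrow> ('a \<Rightarrow>\<^sub>L 'b)" where
  "fderiv f x = Blinfun (frechet_derivative f (at x))"

abbreviation D1 :: "('a::euclidean_space \<Rightarrow> real) \<Rightarrow> 'a \<Rightarrow> ('a \<Rightarrow>\<^sub>L real)" where
  "D1 f \<equiv> fderiv f"

abbreviation D2 :: "('a::euclidean_space \<Rightarrow> real) \<Rightarrow> 'a \<Rightarrow> ('a \<Rightarrow>\<^sub>L 'a \<Rightarrow>\<^sub>L real)" where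
  "D2 f \<equiv> fderiv (fderiv f)"

abbreviation D3 :: "('a::euclidean_space \<Rightarrow> real) \<Rightarrow> 'a \<Rightarrow> ('a \<Rightarrow>\<^sub>L 'a \<Rightarrow>\<^sub>L 'a \<Rightarrow>\<^sub>L real)" where
  "D3 f \<equiv> fderiv (fderiv (fderiv f))"

definition three_times_differentiable :: "('a::euclidean_space \<Rightarrow> real) \<Rightarrow> bool" where
  "three_times_differentiable f \<longleftrightarrow>
     (\<forall>x. f differentiable (at x) \<and> D1 f differentiable (at x) \<and> D2 f differentiable (at x))"

definition grad :: "('a::real_inner \<Rightarrow> real) \<Rightarrow> 'a \<Rightarrow> 'a" where
  "grad f x = (THE g. GDERIV f x :> g)"

definition hessian :: "(real^'n \<Rightarrow> real) \<Rightarrow> real^'n \<Rightarrow> real^'n^'n" where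
  "hessian f x = jacobian (grad f) (at x)"

subsection \<open>Extended-valued convex functions and the composite objective\<close>

definition edom :: "('a \<Rightarrow> ereal) \<Rightarrow> 'a set" where
  "edom \<psi> = {x. \<psi> x < \<infinity>}"

definition econvex :: "('a::real_vector \<Rightarrow> ereal) \<Rightarrow> bool" where
  "econvex \<psi> \<longleftrightarrow> (\<forall>x y. \<forall>u\<in>{0<..<1}.
     \<psi> ((1 - u) *\<^sub>R x + u *\<^sub>R y) \<le> ereal (1 - u) * \<psi> x + ereal u * \<psi> y)"

definition subdiff :: "('a::real_inner \<Rightarrow> ereal) \<Rightarrow> 'a \<Rightarrow> 'a set" where
  "subdiff \<psi> x = {g. x \<in> edom \<psi> \<and> (\<forall>y. \<psi> x + ereal (g \<bullet> (y - x)) \<le> \<psi> y)}"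

definition composite :: "('a \<Rightarrow> real) \<Rightarrow> ('a \<Rightarrow> ereal) \<Rightarrow> 'a \<Rightarrow> ereal" where
  "composite f \<psi> x = ereal (f x) + \<psi> x"

definition subdiff_composite ::
  "('a::real_inner \<Rightarrow> real) \<Rightarrow> ('a \<Rightarrow> ereal) \<Rightarrow> 'a \<Rightarrow> 'a set" where
  "subdiff_composite f \<psi> x = (\<lambda>g. grad f x + g) ` subdiff \<psi> x"

subsection \<open>Third-order models\<close>

definition taylor3 :: "(real^'n \<Rightarrow> real) \<Rightarrow> real^'n \<Rightarrow> real^'n \<Rightarrow> real" where
  "taylor3 f x y = (let h = y - x in
     f x + D1 f x h + D2 f x h h / fact 2 + D3 f x h h h / fact 3)"

definition Omega :: "(real^'n \<Rightarrow> real) \<Rightarrow> real^'n \<Rightarrow> real \<Rightarrow> real^'n \<Rightarrow> real" where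
  "Omega f x M y = taylor3 f x y + M / 8 * norm (y - x) ^ 4"

definition rho :: "(real^'n \<Rightarrow> real) \<Rightarrow> real^'n \<Rightarrow> real \<Rightarrow> real^'n \<Rightarrow> real" where
  "rho f x M y = 1/2 * ((hessian f x *v (y - x)) \<bullet> (y - x)) + M / 8 * norm (y - x) ^ 4"

definition bregman :: "('a::real_inner \<Rightarrow> real) \<Rightarrow> 'a \<Rightarrow> 'a \<Rightarrow> real" where
  "bregman \<rho> u v = \<rho> v - \<rho> u - grad \<rho> u \<bullet> (v - u)"

subsection \<open>Algorithm 1\<close>

text \<open>Throughout, \<open>x\<close>, \<open>G\<close>, \<open>M\<close>, \<open>\<epsilon>\<close> is the input, \<open>G\<close> being the chosen element of the
  subdifferential of the composite objective at \<open>x\<close>; \<open>y\<close> is the iterate \<open>y\<^sub>k\<close> and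
  \<open>y'\<close> is \<open>y\<^sub>k\<^sub>+\<^sub>1\<close>.\<close>

definition L_const :: "(real^'n \<Rightarrow> real) \<Rightarrow> real^'n \<Rightarrow> real^'n \<Rightarrow> real \<Rightarrow> real" where
  "L_const f x G M =
     trace (hessian f x) + 3 * M / 2 * (96 * norm G / M) powr (2/3)"

definition beta_const :: "(real^'n \<Rightarrow> real) \<Rightarrow> real^'n \<Rightarrow> real^'n \<Rightarrow> real \<Rightarrow> real" where
  "beta_const f x G M =
     1/2 * trace (hessian f x) * (96 * norm G / M) powr (2/3)
     + M / 8 * (96 * norm G / M) powr (4/3)"

definition inner_iterate ::
  "(real^'n \<Rightarrow> real) \<Rightarrow> (real^'n \<Rightarrow> ereal) \<Rightarrow> real^'n \<Rightarrow> real \<Rightarrow> real^'n \<Rightarrow> real^'n \<Rightarrow> bool" where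
  "inner_iterate f \<psi> x M y y' \<longleftrightarrow>
     is_arg_min (\<lambda>u. ereal (grad (Omega f x M) y \<bullet> (u - y) + 3 * bregman (rho f x M) y u) + \<psi> u)
       (\<lambda>_. True) y'"

definition g_psi :: "(real^'n \<Rightarrow> real) \<Rightarrow> real^'n \<Rightarrow> real \<Rightarrow> real^'n \<Rightarrow> real^'n \<Rightarrow> real^'n" where
  "g_psi f x M y y' =
     - grad (Omega f x M) y + 3 *\<^sub>R (grad (rho f x M) y - grad (rho f x M) y')"

definition residual :: "(real^'n \<Rightarrow> real) \<Rightarrow> real^'n \<Rightarrow> real \<Rightarrow> real^'n \<Rightarrow> real^'n \<Rightarrow> real" where
  "residual f x M y y' = norm (grad (Omega f x M) y' + g_psi f x M y y')"

text \<open>\<open>Success\<close> and \<open>Failure\<close> stand for termination with \<open>\<alpha> = 0\<close> and \<open>\<alpha> = 1\<close>.\<close>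

datatype verdict = Success | Failure | Continue

definition inner_verdict ::
  "(real^'n \<Rightarrow> real) \<Rightarrow> real \<Rightarrow> real^'n \<Rightarrow> real^'n \<Rightarrow> real \<Rightarrow> nat \<Rightarrow> real^'n \<Rightarrow> real^'n \<Rightarrow> verdict" where
  "inner_verdict f \<epsilon> x G M k y y' =
     (let r = residual f x M y y' in
      if r \<le> \<epsilon> / 7 \<or> r \<le> M / 6 * norm (y' - x) ^ 3 then Success
      else if r ^ 4 > 3 ^ 8 * L_const f x G M ^ 4 * beta_const f x G M / (2 * M * (6/5) ^ k)
        then Failure
      else Continue)"

subsection \<open>Algorithm 3\<close>

text \<open>The data \<open>x\<^sub>t\<close>, \<open>v\<^sub>t\<close>, \<open>A\<^sub>t\<close>, \<open>M\<^sub>t\<close>, \<open>\<phi>\<^sub>t\<close>.\<close>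

record 'v outer =
  st_x :: 'v
  st_v :: 'v
  st_A :: real
  st_M :: real
  st_phi :: "'v \<Rightarrow> ereal"

definition initial_outer :: "'v::real_normed_vector \<Rightarrow> real \<Rightarrow> 'v outer" where
  "initial_outer x0 M0 =
     \<lparr>st_x = x0, st_v = x0, st_A = 0, st_M = M0, st_phi = (\<lambda>x. ereal (1/4 * norm (x - x0) ^ 4))\<rparr>"

definition first_i :: "real \<Rightarrow> 'v outer \<Rightarrow> nat" where
  "first_i M0 S = (LEAST i. 2 ^ i * st_M S \<ge> 2 * M0)"

definition trial_M :: "'v outer \<Rightarrow> nat \<Rightarrow> real" where
  "trial_M S i = 2 ^ i * st_M S"

definition trial_a :: "'v outer \<Rightarrow> nat \<Rightarrow> real \<Rightarrow> bool" where
  "trial_a S i a \<longleftrightarrow> a > 0 \<and> a ^ 4 = 4\<^sup>2 * (st_A S + a) ^ 3 / (18 ^ 3 * trial_M S i)"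

definition trial_z :: "'v::real_vector outer \<Rightarrow> real \<Rightarrow> 'v" where
  "trial_z S a = (let \<gamma> = a / (st_A S + a) in (1 - \<gamma>) *\<^sub>R st_x S + \<gamma> *\<^sub>R st_v S)"

text \<open>\<open>Solving S i a G k y\<close>: the outer data are \<open>S\<close>, Algorithm 1 has been called for the
  current \<open>i\<close> with \<open>a\<^sub>t\<^sub>,\<^sub>i = a\<close>, at the point \<open>trial_z S a\<close> with chosen subgradient \<open>G\<close>, and is
  about to compute \<open>y\<^sub>k\<^sub>+\<^sub>1\<close> from \<open>y\<^sub>k = y\<close>.\<close>

datatype 'v config = Solving "'v outer" nat real 'v nat 'v | Halted

text \<open>Steps 1.1--1.3 up to the initialization of Algorithm 1.\<close>

definition begin_trial ::
  "(real^'n \<Rightarrow> real) \<Rightarrow> (real^'n \<Rightarrow> ereal) \<Rightarrow> (real^'n) outer \<Rightarrow> nat \<Rightarrow> (real^'n) config \<Rightarrow> bool" where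
  "begin_trial f \<psi> S i c \<longleftrightarrow>
     (\<exists>a G. trial_a S i a \<and> G \<in> subdiff_composite f \<psi> (trial_z S a) \<and>
            c = Solving S i a G 0 (trial_z S a))"

definition next_phi ::
  "(real^'n \<Rightarrow> real) \<Rightarrow> (real^'n \<Rightarrow> ereal) \<Rightarrow> (real^'n) outer \<Rightarrow> real \<Rightarrow> real^'n \<Rightarrow> real^'n \<Rightarrow> ereal"
  where
  "next_phi f \<psi> S a xp x =
     st_phi S x + ereal a * (ereal (f xp + grad f xp \<bullet> (x - xp)) + \<psi> x)"

text \<open>Steps 2 and 3.\<close>

definition outer_update ::
  "(real^'n \<Rightarrow> real) \<Rightarrow> (real^'n \<Rightarrow> ereal) \<Rightarrow> (real^'n) outer \<Rightarrow> nat \<Rightarrow> real \<Rightarrow> real^'n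
    \<Rightarrow> (real^'n) outer \<Rightarrow> bool" where
  "outer_update f \<psi> S i a xp S' \<longleftrightarrow>
     (\<exists>v. is_arg_min (next_phi f \<psi> S a xp) (\<lambda>x. x \<in> edom \<psi>) v \<and>
          S' = \<lparr>st_x = xp, st_v = v, st_A = st_A S + a, st_M = trial_M S i / 2,
                st_phi = next_phi f \<psi> S a xp\<rparr>)"

definition sufficient_decrease :: "real \<Rightarrow> 'v::real_inner \<Rightarrow> 'v \<Rightarrow> 'v \<Rightarrow> bool" where
  "sufficient_decrease M z xp Gp \<longleftrightarrow>
     Gp \<bullet> (z - xp) \<ge> 1 / (6 * M powr (1/3)) * norm Gp powr (4/3)"

text \<open>Labelled transitions. A transition out of a \<open>Solving\<close> configuration is exactly one iteration
  of Algorithm 1 (one computation of a point \<open>y\<^sub>k\<^sub>+\<^sub>1\<close>) together with the bookkeeping of Algorithm 3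
  that follows it. Its label is \<open>Some (x\<^sup>+, \<nabla>)\<close> if it generates the trial point \<open>x\<^sup>+\<close>, where
  \<open>\<nabla> = \<nabla>f(x\<^sup>+) + g\<^sub>\<psi>(x\<^sup>+)\<close>, and \<open>None\<close> otherwise.\<close>

inductive step ::
  "(real^'n \<Rightarrow> real) \<Rightarrow> (real^'n \<Rightarrow> ereal) \<Rightarrow> real \<Rightarrow> real
    \<Rightarrow> (real^'n) config \<Rightarrow> ((real^'n) \<times> (real^'n)) option \<Rightarrow> (real^'n) config \<Rightarrow> bool"
  for f \<psi> M0 \<epsilon> where
  inner_continue:
    "\<lbrakk>z = trial_z S a; M = trial_M S i; inner_iterate f \<psi> z M y y';
      inner_verdict f \<epsilon> z G M k y y' = Continue\<rbrakk>
     \<Longrightarrow> step f \<psi> M0 \<epsilon> (Solving S i a G k y) None (Solving S i a G (Suc k) y')"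
| inner_failure:
    "\<lbrakk>z = trial_z S a; M = trial_M S i; inner_iterate f \<psi> z M y y';
      inner_verdict f \<epsilon> z G M k y y' = Failure;
      Gp = grad f y' + g_psi f z M y y';
      begin_trial f \<psi> S (Suc i) c\<rbrakk>
     \<Longrightarrow> step f \<psi> M0 \<epsilon> (Solving S i a G k y) (Some (y', Gp)) c"
| halt:
    "\<lbrakk>z = trial_z S a; M = trial_M S i; inner_iterate f \<psi> z M y y';
      inner_verdict f \<epsilon> z G M k y y' = Success;
      Gp = grad f y' + g_psi f z M y y';
      norm Gp \<le> \<epsilon>\<rbrakk>
     \<Longrightarrow> step f \<psi> M0 \<epsilon> (Solving S i a G k y) (Some (y', Gp)) Halted"
| no_decrease:
    "\<lbrakk>z = trial_z S a; M = trial_M S i; inner_iterate f \<psi> z M y y';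
      inner_verdict f \<epsilon> z G M k y y' = Success;
      Gp = grad f y' + g_psi f z M y y';
      norm Gp > \<epsilon>; \<not> sufficient_decrease M z y' Gp;
      begin_trial f \<psi> S (Suc i) c\<rbrakk>
     \<Longrightarrow> step f \<psi> M0 \<epsilon> (Solving S i a G k y) (Some (y', Gp)) c"
| decrease:
    "\<lbrakk>z = trial_z S a; M = trial_M S i; inner_iterate f \<psi> z M y y';
      inner_verdict f \<epsilon> z G M k y y' = Success;
      Gp = grad f y' + g_psi f z M y y';
      norm Gp > \<epsilon>; sufficient_decrease M z y' Gp;
      outer_update f \<psi> S i a y' S';
      begin_trial f \<psi> S' (first_i M0 S') c\<rbrakk>
     \<Longrightarrow> step f \<psi> M0 \<epsilon> (Solving S i a G k y) (Some (y', Gp)) c"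
| halted: "step f \<psi> M0 \<epsilon> Halted None Halted"

text \<open>A complete run: infinite, or halted from some index on. Completeness of the run incorporates the
  standing assumption that all minimizers (and subgradients) required along the way exist. Before
  halting, \<open>out j\<close> is the label of the iteration of Algorithm 1 with number \<open>j + 1\<close>, counted over
  all executions of Algorithm 1.\<close>

definition algorithm3_run ::
  "(real^'n \<Rightarrow> real) \<Rightarrow> (real^'n \<Rightarrow> ereal) \<Rightarrow> real^'n \<Rightarrow> real \<Rightarrow> real
    \<Rightarrow> (nat \<Rightarrow> (real^'n) config) \<Rightarrow> (nat \<Rightarrow> ((real^'n) \<times> (real^'n)) option) \<Rightarrow> bool" where
  "algorithm3_run f \<psi> x0 M0 \<epsilon> c out \<longleftrightarrow>
     begin_trial f \<psi> (initial_outer x0 M0) (first_i M0 (initial_outer x0 M0)) (c 0) \<and>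
     (\<forall>j. step f \<psi> M0 \<epsilon> (c j) (out j) (c (Suc j)))"

definition approx_minimizer ::
  "(real^'n \<Rightarrow> real) \<Rightarrow> (real^'n \<Rightarrow> ereal) \<Rightarrow> real^'n \<Rightarrow> real \<Rightarrow> real^'n \<Rightarrow> real^'n \<Rightarrow> bool" where
  "approx_minimizer f \<psi> xstar \<epsilon> x G \<longleftrightarrow>
     min (ereal (norm G)) (composite f \<psi> x - composite f \<psi> xstar) \<le> ereal \<epsilon>"

end

theory Submission
  imports Defs
begin

text \<open>When \<open>M \<ge> 16 L\<^sub>f\<close>, convexity of \<open>f\<close> at \<open>x \<plusminus> 2 m\<close> bounds \<open>D\<^sup>3f(x)[m]\<close> by the Hessian, and the
  model \<open>\<Omega>\<close> is smooth and strongly convex relative to \<open>\<rho>\<close> with constants \<open>3/2\<close> and \<open>1/2\<close>. Hence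
  \<open>\<beta>\<^sub>\<rho>\<close> contracts by \<open>5/6\<close> per iteration of Algorithm 1. Since \<open>\<psi>\<close> need not be lower
  semicontinuous, the model may lack a minimizer, so the contraction is measured towards the next
  iterate \<open>y\<^sub>k\<^sub>+\<^sub>1\<close>; this suffices to exclude failures. Every success then decreases sufficiently,
  so the trial values of \<open>M\<close> stay below \<open>max (2 M\<^sub>0) (32 L\<^sub>f)\<close>. For arbitrary \<open>M\<close> the failure test
  itself forces geometric decay of the residual, and thus \<open>O(|log \<epsilon>|)\<close> iterations per execution,
  as soon as the data at \<open>z\<^sub>t\<close> are bounded. They are: the estimating functions give
  \<open>A\<^sub>t F(x\<^sub>t) \<le> \<phi>\<^sub>t(v\<^sub>t) \<le> \<phi>\<^sub>t(x\<^sub>0) \<le> A\<^sub>t F(x\<^sub>0)\<close>, which keeps \<open>x\<^sub>t\<close> in the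
  initial level set, and uniform convexity of \<open>\<phi>\<^sub>t\<close> keeps \<open>v\<^sub>t\<close> close to \<open>x\<^sup>*\<close>. Finally \<open>A\<^sub>t\<close> grows like \<open>t\<^sup>4\<close>.\<close>

section \<open>Third-order Taylor bounds\<close>

lemma fderiv_has_derivative:
  "f differentiable (at x) \<Longrightarrow> (f has_derivative blinfun_apply (fderiv f x)) (at x)"
  unfolding fderiv_def
  by (metis bounded_linear_Blinfun_apply frechet_derivative_works has_derivative_bounded_linear)

lemma has_derivative_fderiv_compose:
  assumes "f differentiable (at (g x))" and "(g has_derivative g') (at x)"
  shows "((\<lambda>y. f (g y)) has_derivative (\<lambda>h. fderiv f (g x) (g' h))) (at x)"
  using has_derivative_compose[OF assms(2) fderiv_has_derivative[OF assms(1)]] .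

text \<open>The second difference is the increment along \<open>t u\<close> of the map sending
  \<open>w\<close> to \<open>F (w + t v) - F w\<close>. The first-order expansion of
  \<open>fderiv F\<close> at the single point \<open>x\<close> gives the derivative of this map up
  to \<open>o(t)\<close>; the mean value inequality over a segment of length \<open>O(t)\<close>
  then leaves an error \<open>o(t^2)\<close>.\<close>

lemma second_difference_bound:
  fixes F :: "'a::euclidean_space \<Rightarrow> 'b::real_normed_vector"
  assumes F: "\<And>y. F differentiable (at y)" and F': "fderiv F differentiable (at x)" and e: "e > 0"
  shows "\<exists>d>0. \<forall>t. 0 < t \<and> t < d \<longrightarrow>
    norm (F (x + t *\<^sub>R u + t *\<^sub>R v) - F (x + t *\<^sub>R u) - F (x + t *\<^sub>R v) + F x
          - t\<^sup>2 *\<^sub>R fderiv (fderiv F) x v u) \<le> t\<^sup>2 * e"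
proof -
  let ?A = "fderiv (fderiv F) x"
  \<comment> \<open>\<open>K\<close> serves two purposes: it keeps the shifted points within radius
    \<open>d\<close> when \<open>t < d / K\<close>, and it brings the accumulated error below
    \<open>t^2 * e\<close>. The added ones keep it positive when \<open>u = 0\<close>.\<close>
  define K where "K = (norm u + 1) * (norm u + norm v + norm u + 1)"
  have K: "K > 0" unfolding K_def by (intro mult_pos_pos add_nonneg_pos) auto
  have "1 * (norm u + norm v) \<le> K" "norm u * (norm u + norm v + norm u) \<le> K"
    unfolding K_def by (intro mult_mono; simp)+
  then have Kuv: "norm u + norm v \<le> K" and Ku: "norm u * (norm u + norm v + norm u) \<le> K" by simp_all
  have "\<exists>d>0. \<forall>y. norm (y - x) < d \<longrightarrow> norm (fderiv F y - fderiv F x - ?A (y - x)) \<le> (e/K) * norm (y - x)"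
    using fderiv_has_derivative[OF F'] divide_pos_pos[OF e K] unfolding has_derivative_at_alt by blast
  then obtain d where d: "d > 0"
    and b: "\<And>y. norm (y - x) < d \<Longrightarrow> norm (fderiv F y - fderiv F x - ?A (y - x)) \<le> (e/K) * norm (y - x)"
    by blast
  show ?thesis
  proof (intro exI[of _ "d / K"] conjI allI impI)
    show "d / K > 0" using d K by simp
  next
    fix t :: real assume t: "0 < t \<and> t < d / K"
    show "norm (F (x + t *\<^sub>R u + t *\<^sub>R v) - F (x + t *\<^sub>R u) - F (x + t *\<^sub>R v) + F x
          - t\<^sup>2 *\<^sub>R ?A v u) \<le> t\<^sup>2 * e"
    proof -
    define g where "g = (\<lambda>w. F (w + t *\<^sub>R v) - F w - t *\<^sub>R ?A v w)"
    have nm: "norm (s *\<^sub>R t *\<^sub>R u + t *\<^sub>R v) \<le> t * (norm u + norm v)"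
             "norm (s *\<^sub>R t *\<^sub>R u) \<le> t * norm u" if "s \<in> {0..1}" for s
    proof -
      have a: "norm (s *\<^sub>R t *\<^sub>R u) \<le> t * norm u" using that t by (simp add: mult_left_le_one_le)
      then show "norm (s *\<^sub>R t *\<^sub>R u) \<le> t * norm u" .
      show "norm (s *\<^sub>R t *\<^sub>R u + t *\<^sub>R v) \<le> t * (norm u + norm v)"
        using norm_triangle_ineq[of "s *\<^sub>R t *\<^sub>R u" "t *\<^sub>R v"] a t by (simp add: algebra_simps)
    qed
    have "t * (norm u + norm v) \<le> t * K" using t Kuv by (intro mult_left_mono) auto
    also have "\<dots> < d" using t K by (simp add: field_simps)
    finally have small: "t * (norm u + norm v) < d" .
    have bd: "norm (g (x + t *\<^sub>R u) - g x) \<le> norm (t *\<^sub>R u) * (e/K * (t * (norm u + norm v + norm u)))"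
    proof (rule differentiable_bound_segment[where G = UNIV and f' = "\<lambda>w h. fderiv F (w + t *\<^sub>R v) h - fderiv F w h - t *\<^sub>R ?A v h"])
      show "(g has_derivative (\<lambda>h. fderiv F (w + t *\<^sub>R v) h - fderiv F w h - t *\<^sub>R ?A v h)) (at w)" for w
        unfolding g_def
        by (auto intro!: derivative_eq_intros has_derivative_fderiv_compose[OF F] fderiv_has_derivative[OF F])
    next
      fix s :: real assume s: "s \<in> {0..1}"
      let ?w = "x + s *\<^sub>R t *\<^sub>R u"
      have 1: "norm (fderiv F (?w + t *\<^sub>R v) - fderiv F x - ?A (s *\<^sub>R t *\<^sub>R u + t *\<^sub>R v)) \<le> e/K * (t * (norm u + norm v))"
      proof -
        have "norm (fderiv F (?w + t *\<^sub>R v) - fderiv F x - ?A ((?w + t *\<^sub>R v) - x)) \<le> e/K * norm ((?w + t *\<^sub>R v) - x)"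
          by (rule b) (use nm(1)[OF s] small in \<open>simp add: algebra_simps\<close>)
        also have "\<dots> \<le> e/K * (t * (norm u + norm v))"
          using nm(1)[OF s] e K by (intro mult_left_mono) (auto simp: algebra_simps)
        finally show ?thesis by (simp add: algebra_simps)
      qed
      have 2: "norm (fderiv F ?w - fderiv F x - ?A (s *\<^sub>R t *\<^sub>R u)) \<le> e/K * (t * norm u)"
      proof -
        have "t * norm u \<le> t * (norm u + norm v)" using t by (intro mult_left_mono) auto
        then have "norm (fderiv F ?w - fderiv F x - ?A (?w - x)) \<le> e/K * norm (?w - x)"
          by (intro b) (use nm(2)[OF s] small in \<open>simp add: algebra_simps\<close>)
        also have "\<dots> \<le> e/K * (t * norm u)"
          using nm(2)[OF s] e K by (intro mult_left_mono) (auto simp: algebra_simps)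
        finally show ?thesis by simp
      qed
      have "(\<lambda>h. fderiv F (?w + t *\<^sub>R v) h - fderiv F ?w h - t *\<^sub>R ?A v h) =
          blinfun_apply ((fderiv F (?w + t *\<^sub>R v) - fderiv F x - ?A (s *\<^sub>R t *\<^sub>R u + t *\<^sub>R v))
            - (fderiv F ?w - fderiv F x - ?A (s *\<^sub>R t *\<^sub>R u)))"
        by (auto simp: blinfun.bilinear_simps algebra_simps)
      then have "onorm (\<lambda>h. fderiv F (?w + t *\<^sub>R v) h - fderiv F ?w h - t *\<^sub>R ?A v h) =
        norm ((fderiv F (?w + t *\<^sub>R v) - fderiv F x - ?A (s *\<^sub>R t *\<^sub>R u + t *\<^sub>R v))
            - (fderiv F ?w - fderiv F x - ?A (s *\<^sub>R t *\<^sub>R u)))"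
        by (simp add: norm_blinfun.rep_eq)
      also have "\<dots> \<le> e/K * (t * (norm u + norm v)) + e/K * (t * norm u)"
        using norm_triangle_ineq4 1 2 by (smt (verit))
      finally show "onorm (\<lambda>h. fderiv F (?w + t *\<^sub>R v) h - fderiv F ?w h - t *\<^sub>R ?A v h) \<le> e/K * (t * (norm u + norm v + norm u))"
        by (simp add: algebra_simps)
    qed auto
    have "g (x + t *\<^sub>R u) - g x = F (x + t *\<^sub>R u + t *\<^sub>R v) - F (x + t *\<^sub>R u) - F (x + t *\<^sub>R v) + F x
          - t\<^sup>2 *\<^sub>R ?A v u"
      by (simp add: g_def blinfun.bilinear_simps algebra_simps power2_eq_square)
    moreover have "norm (t *\<^sub>R u) * (e/K * (t * (norm u + norm v + norm u))) =
       t\<^sup>2 * e * ((norm u * (norm u + norm v + norm u)) / K)"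
      using t by (simp add: power2_eq_square)
    moreover have "\<dots> \<le> t\<^sup>2 * e * 1"
      using Ku K e by (intro mult_left_mono) auto
    ultimately show ?thesis using bd by (metis (no_types, lifting) mult.right_neutral order_trans)
    qed
  qed
qed

text \<open>Swapping \<open>u\<close> and \<open>v\<close> leaves the second difference unchanged,
  so both mixed derivatives approximate the same quantity.\<close>

lemma fderiv_fderiv_symmetric:
  fixes F :: "'a::euclidean_space \<Rightarrow> 'b::real_normed_vector"
  assumes F: "\<And>y. F differentiable (at y)" and F': "fderiv F differentiable (at x)"
  shows "fderiv (fderiv F) x u v = fderiv (fderiv F) x v u"
proof -
  let ?A = "fderiv (fderiv F) x"
  have "norm (?A u v - ?A v u) \<le> 0 + e" if "e > 0" for e
  proof -
    obtain d1 where d1: "d1 > 0" and 1: "\<And>t. 0 < t \<and> t < d1 \<Longrightarrow>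
      norm (F (x + t *\<^sub>R u + t *\<^sub>R v) - F (x + t *\<^sub>R u) - F (x + t *\<^sub>R v) + F x - t\<^sup>2 *\<^sub>R ?A v u) \<le> t\<^sup>2 * (e/2)"
      using second_difference_bound[OF F F' half_gt_zero[OF \<open>e > 0\<close>]] by meson
    obtain d2 where d2: "d2 > 0" and 2: "\<And>t. 0 < t \<and> t < d2 \<Longrightarrow>
      norm (F (x + t *\<^sub>R v + t *\<^sub>R u) - F (x + t *\<^sub>R v) - F (x + t *\<^sub>R u) + F x - t\<^sup>2 *\<^sub>R ?A u v) \<le> t\<^sup>2 * (e/2)"
      using second_difference_bound[OF F F' half_gt_zero[OF \<open>e > 0\<close>]] by meson
    define t where "t = min d1 d2 / 2"
    have t: "0 < t" "t < d1" "t < d2" using d1 d2 by (auto simp: t_def)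
    define X where "X = F (x + t *\<^sub>R u + t *\<^sub>R v) - F (x + t *\<^sub>R u) - F (x + t *\<^sub>R v) + F x"
    have "norm (X - t\<^sup>2 *\<^sub>R ?A v u) \<le> t\<^sup>2 * (e/2)" using 1[of t] t by (simp add: X_def)
    moreover have "norm (X - t\<^sup>2 *\<^sub>R ?A u v) \<le> t\<^sup>2 * (e/2)"
      using 2[of t] t by (simp add: X_def algebra_simps)
    ultimately have "norm ((X - t\<^sup>2 *\<^sub>R ?A v u) - (X - t\<^sup>2 *\<^sub>R ?A u v)) \<le> t\<^sup>2 * (e/2) + t\<^sup>2 * (e/2)"
      using norm_triangle_ineq4 by (smt (verit))
    also have "(X - t\<^sup>2 *\<^sub>R ?A v u) - (X - t\<^sup>2 *\<^sub>R ?A u v) = t\<^sup>2 *\<^sub>R (?A u v - ?A v u)"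
      by (simp add: algebra_simps)
    finally have "t\<^sup>2 * norm (?A u v - ?A v u) \<le> t\<^sup>2 * e" by (simp add: mult.commute)
    then show ?thesis using t by simp
  qed
  then have "norm (?A u v - ?A v u) \<le> 0" by (rule field_le_epsilon)
  then show ?thesis by simp
qed

section \<open>Functions with Lipschitz third derivative\<close>

locale lipschitz_third =
  fixes f :: "'a::euclidean_space \<Rightarrow> real" and L :: real
  assumes smooth: "three_times_differentiable f"
    and D3_lipschitz: "\<And>x y. norm (D3 f x - D3 f y) \<le> L * norm (x - y)"
begin

lemma diff1: "f differentiable (at x)" and diff2: "D1 f differentiable (at x)"
  and diff3: "D2 f differentiable (at x)"
  using smooth by (auto simp: three_times_differentiable_def)

lemma D2_deriv: "(g has_derivative g') (at x) \<Longrightarrow> ((\<lambda>y. D1 f (g y)) has_derivative (\<lambda>h. D2 f (g x) (g' h))) (at x)"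
  by (rule has_derivative_fderiv_compose[OF diff2])

lemma D3_deriv: "(g has_derivative g') (at x) \<Longrightarrow> ((\<lambda>y. D2 f (g y)) has_derivative (\<lambda>h. D3 f (g x) (g' h))) (at x)"
  by (rule has_derivative_fderiv_compose[OF diff3])

lemma L_nonneg: "L \<ge> 0"
proof -
  obtain b :: 'a where "b \<in> Basis" using nonempty_Basis by blast
  then have "0 \<le> L * norm (b - 0)" using D3_lipschitz[of b 0] norm_ge_zero order_trans by blast
  then show ?thesis using \<open>b \<in> Basis\<close> by simp
qed

lemma D2_sym: "D2 f x u v = D2 f x v u"
  by (rule fderiv_fderiv_symmetric[OF diff1 diff2])

lemma D3_sym12: "D3 f x u v = D3 f x v u"
  by (rule fderiv_fderiv_symmetric[OF diff2 diff3])

text \<open>Obtained by differentiating the symmetry of \<open>D2 f\<close> in direction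
  \<open>w\<close>; with \<open>D3_sym12\<close> it makes \<open>D3 f x\<close> fully
  symmetric.\<close>

lemma D3_sym23: "D3 f x w u v = D3 f x w v u"
proof -
  have "((\<lambda>y. D2 f y u v) has_derivative (\<lambda>h. D3 f x h u v)) (at x)" for u v
    by (auto intro!: derivative_eq_intros D3_deriv simp: blinfun.bilinear_simps)
  from this[of u v] this[of v u] have "((\<lambda>y. D2 f y u v) has_derivative (\<lambda>h. D3 f x h u v)) (at x)"
    "((\<lambda>y. D2 f y u v) has_derivative (\<lambda>h. D3 f x h v u)) (at x)"
    by (auto simp: D2_sym[of _ u v])
  then have "(\<lambda>h. D3 f x h u v) = (\<lambda>h. D3 f x h v u)" by (rule has_derivative_unique)
  then show ?thesis by meson
qed

text \<open>Mean value inequality for \<open>D2 f\<close> minus its linearization at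
  \<open>x\<close>. The sharp constant is \<open>L / 2\<close>; the lost factor is absorbed later by
  the threshold \<open>M \<ge> 16 * L\<close>.\<close>

lemma D2_remainder: "norm (D2 f (x + m) - D2 f x - D3 f x m) \<le> L * norm m ^ 2"
proof -
  have "norm ((D2 f (x + m) - D3 f x (x + m)) - (D2 f x - D3 f x x)) \<le> norm m * (L * norm m)"
  proof (rule differentiable_bound_segment[where G = UNIV and f' = "\<lambda>y h. D3 f y h - D3 f x h"])
    show "((\<lambda>y. D2 f y - D3 f x y) has_derivative (\<lambda>h. D3 f y h - D3 f x h)) (at y)" for y
      by (auto intro!: derivative_eq_intros D3_deriv)
  next
    fix t :: real assume t: "t \<in> {0..1}"
    have "onorm (\<lambda>h. D3 f (x + t *\<^sub>R m) h - D3 f x h) = norm (D3 f (x + t *\<^sub>R m) - D3 f x)"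
      by (simp add: norm_blinfun.rep_eq minus_blinfun.rep_eq)
    also have "\<dots> \<le> L * norm (t *\<^sub>R m)" using D3_lipschitz[of "x + t *\<^sub>R m" x] by simp
    also have "\<dots> \<le> L * norm m" using t L_nonneg by (intro mult_left_mono) (auto simp: mult_left_le_one_le)
    finally show "onorm (\<lambda>h. D3 f (x + t *\<^sub>R m) h - D3 f x h) \<le> L * norm m" .
  qed auto
  then show ?thesis by (simp add: blinfun.bilinear_simps algebra_simps power2_eq_square)
qed

text \<open>The derivative of this error is the error of \<open>D2_remainder\<close>, so a second
  mean value step gains one power of \<open>norm h\<close>.\<close>

lemma D1_remainder:
  "norm (D1 f (x + h) - D1 f x - D2 f x h - (1/2) *\<^sub>R D3 f x h h) \<le> L * norm h ^ 3"
proof -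
  define E where "E = (\<lambda>y. D1 f y - D2 f x (y - x) - (1/2) *\<^sub>R D3 f x (y - x) (y - x))"
  have "norm (E (x + h) - E x) \<le> norm h * (L * norm h ^ 2)"
  proof (rule differentiable_bound_segment[where G = UNIV and f' = "\<lambda>y. blinfun_apply (D2 f y - D2 f x - D3 f x (y - x))"])
    fix y
    have "(E has_derivative (\<lambda>k. D2 f y k - D2 f x k - (1/2) *\<^sub>R (D3 f x k (y - x) + D3 f x (y - x) k))) (at y)"
      unfolding E_def by (auto intro!: derivative_eq_intros D2_deriv simp: algebra_simps)
    moreover have "D2 f y k - D2 f x k - (1/2) *\<^sub>R (D3 f x k (y - x) + D3 f x (y - x) k)
        = (D2 f y - D2 f x - D3 f x (y - x)) k" for k
      by (simp add: blinfun.diff_left D3_sym12[of x k "y - x"] scaleR_2[symmetric] del: scaleR_2)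
    ultimately show "(E has_derivative blinfun_apply (D2 f y - D2 f x - D3 f x (y - x))) (at y)"
      by simp
  next
    fix t :: real assume t: "t \<in> {0..1}"
    have "onorm (blinfun_apply (D2 f (x + t *\<^sub>R h) - D2 f x - D3 f x (x + t *\<^sub>R h - x)))
      = norm (D2 f (x + t *\<^sub>R h) - D2 f x - D3 f x (t *\<^sub>R h))"
      by (simp add: norm_blinfun.rep_eq)
    also have "\<dots> \<le> L * norm (t *\<^sub>R h) ^ 2" by (rule D2_remainder)
    also have "\<dots> \<le> L * norm h ^ 2" using t L_nonneg
      by (intro mult_left_mono power_mono) (auto simp: mult_left_le_one_le)
    finally show "onorm (blinfun_apply (D2 f (x + t *\<^sub>R h) - D2 f x - D3 f x (x + t *\<^sub>R h - x))) \<le> L * norm h ^ 2" .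
  qed auto
  then show ?thesis by (simp add: E_def algebra_simps power2_eq_square power3_eq_cube)
qed

end

section \<open>Convexity and quartic regularization\<close>

lemma has_derivative_directional:
  fixes q :: "'a::real_normed_vector \<Rightarrow> 'b::real_normed_vector"
  assumes "(q has_derivative q') (at x)"
  shows "((\<lambda>t. (q (x + t *\<^sub>R d) - q x) /\<^sub>R t) \<longlongrightarrow> q' d) (at_right 0)"
proof -
  have "((\<lambda>t. x + t *\<^sub>R d) has_derivative (\<lambda>t. t *\<^sub>R d)) (at_right 0)"
    by (auto intro!: derivative_eq_intros)
  then have "((\<lambda>t. q (x + t *\<^sub>R d)) has_derivative (\<lambda>t. q' (t *\<^sub>R d))) (at_right 0)"
    using has_derivative_compose[of "\<lambda>t. x + t *\<^sub>R d" _ 0 "{0<..}" q q'] assms by simp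
  moreover have "q' (t *\<^sub>R d) = t *\<^sub>R q' d" for t
    using assms by (simp add: has_derivative_bounded_linear linear_simps(5))
  ultimately have "((\<lambda>t. q (x + t *\<^sub>R d)) has_vector_derivative q' d) (at_right 0)"
    by (simp add: has_vector_derivative_def)
  then have "((\<lambda>t. (q (x + t *\<^sub>R d) - (q x + t *\<^sub>R q' d)) /\<^sub>R \<bar>t\<bar>) \<longlongrightarrow> 0) (at_right 0)"
    unfolding has_vector_derivative_def has_derivative_within by (simp add: inverse_eq_divide)
  moreover have "\<forall>\<^sub>F t in at_right 0. (q (x + t *\<^sub>R d) - (q x + t *\<^sub>R q' d)) /\<^sub>R \<bar>t\<bar>
      = (q (x + t *\<^sub>R d) - q x) /\<^sub>R t - q' d"
    by (rule eventually_at_rightI[of 0 1]) (auto simp: algebra_simps)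
  ultimately have "((\<lambda>t. (q (x + t *\<^sub>R d) - q x) /\<^sub>R t - q' d) \<longlongrightarrow> 0) (at_right 0)"
    by (rule Lim_transform_eventually)
  then show ?thesis by (simp add: Lim_null[symmetric])
qed

lemma convex_tangent_le:
  fixes f :: "'a::real_normed_vector \<Rightarrow> real"
  assumes "convex_on UNIV f" "(f has_derivative f') (at x)"
  shows "f x + f' (y - x) \<le> f y"
proof -
  have "(f (x + t *\<^sub>R (y - x)) - f x) /\<^sub>R t \<le> f y - f x" if "t \<in> {0<..<1}" for t
  proof -
    have "f ((1 - t) *\<^sub>R x + t *\<^sub>R y) \<le> (1 - t) * f x + t * f y"
      using convex_onD[OF assms(1)] that by auto
    also have "(1 - t) *\<^sub>R x + t *\<^sub>R y = x + t *\<^sub>R (y - x)" by (simp add: algebra_simps)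
    finally show ?thesis using that by (simp add: field_simps)
  qed
  then have "f' (y - x) \<le> f y - f x"
    by (intro tendsto_upperbound[OF has_derivative_directional[OF assms(2)]] eventually_at_rightI[of 0 1]) auto
  then show ?thesis by simp
qed

text \<open>\<open>grad\<close> is a definite description, so existence and uniqueness of the
  representing vector are both shown.\<close>

lemma gderiv_grad:
  fixes q :: "'a::euclidean_space \<Rightarrow> real"
  assumes "(q has_derivative q') (at x)"
  shows "GDERIV q x :> grad q x"
proof -
  have "q' h = h \<bullet> (\<Sum>b\<in>Basis. q' b *\<^sub>R b)" for h
  proof -
    have "q' h = q' (\<Sum>b\<in>Basis. (h \<bullet> b) *\<^sub>R b)" by (simp add: euclidean_representation)
    also have "\<dots> = (\<Sum>b\<in>Basis. (h \<bullet> b) * q' b)"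
      using has_derivative_linear[OF assms] by (simp add: linear_sum linear_cmul)
    finally show ?thesis by (simp add: inner_sum_right mult.commute)
  qed
  then have "q' = (\<lambda>h. h \<bullet> (\<Sum>b\<in>Basis. q' b *\<^sub>R b))" by (rule ext)
  then have "GDERIV q x :> (\<Sum>b\<in>Basis. q' b *\<^sub>R b)"
    unfolding gderiv_def using assms by metis
  moreover have "g = g'" if "GDERIV q x :> g" "GDERIV q x :> g'" for g g'
  proof -
    have "(\<lambda>h. h \<bullet> g) = (\<lambda>h. h \<bullet> g')"
      using that unfolding gderiv_def by (rule has_derivative_unique)
    then show ?thesis by (metis inner_commute vector_eq_ldot)
  qed
  ultimately show ?thesis unfolding grad_def by (metis theI)
qed

lemma grad_inner:
  fixes q :: "'a::euclidean_space \<Rightarrow> real"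
  assumes "(q has_derivative q') (at x)"
  shows "grad q x \<bullet> w = q' w"
proof -
  have "(\<lambda>h. h \<bullet> grad q x) = q'"
    using gderiv_grad[OF assms] assms unfolding gderiv_def by (rule has_derivative_unique)
  then show ?thesis by (metis inner_commute)
qed

section \<open>Bregman distance of the quartic norm\<close>

lemma norm_pow4_has_derivative:
  fixes x :: "'a::real_inner"
  shows "((\<lambda>y. norm (y - x) ^ 4) has_derivative (\<lambda>w. 4 * norm (y - x) ^ 2 * ((y - x) \<bullet> w))) (at y)"
proof -
  have "((\<lambda>y. ((y - x) \<bullet> (y - x)) ^ 2) has_derivative (\<lambda>w. 4 * norm (y - x) ^ 2 * ((y - x) \<bullet> w))) (at y)"
    by (auto intro!: derivative_eq_intros simp: power2_norm_eq_inner inner_commute)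
  moreover have "(\<lambda>y. norm (y - x) ^ 4) = (\<lambda>y. ((y - x) \<bullet> (y - x)) ^ 2)"
    by (simp add: power2_norm_eq_inner[symmetric] flip: power_mult)
  ultimately show ?thesis by simp
qed

lemma norm_pow4_expand:
  fixes h s :: "'a::real_inner"
  shows "norm (h + s) ^ 4 - norm h ^ 4 - 4 * norm h ^ 2 * (h \<bullet> s)
    = (2 * (h \<bullet> s) + norm s ^ 2) ^ 2 + 2 * norm h ^ 2 * norm s ^ 2"
proof -
  have "norm (h + s) ^ 2 = norm h ^ 2 + 2 * (h \<bullet> s) + norm s ^ 2"
    by (simp add: power2_norm_eq_inner inner_add inner_commute)
  moreover have "norm (h + s) ^ 4 = (norm (h + s) ^ 2) ^ 2"
    by (simp flip: power_mult)
  ultimately have "norm (h + s) ^ 4 = (norm h ^ 2 + 2 * (h \<bullet> s) + norm s ^ 2) ^ 2"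
    by simp
  then show ?thesis by (simp add: power2_eq_square power4_eq_xxxx algebra_simps)
qed

text \<open>After Cauchy-Schwarz the gap between the two sides is at least the perfect square in the
  proof; this fixes the factor 3.\<close>

lemma norm_pow4_uniformly_convex:
  fixes h s :: "'a::real_inner"
  shows "norm s ^ 4 \<le> 3 * (norm (h + s) ^ 4 - norm h ^ 4 - 4 * norm h ^ 2 * (h \<bullet> s))"
proof -
  have "(h \<bullet> s)\<^sup>2 \<le> norm h ^ 2 * norm s ^ 2"
    using Cauchy_Schwarz_ineq[of h s] by (simp add: power2_norm_eq_inner)
  moreover have "0 \<le> 2 * (3 * (h \<bullet> s) + norm s ^ 2) ^ 2" by simp
  ultimately show ?thesis unfolding norm_pow4_expand
    by (simp add: power2_eq_square power4_eq_xxxx algebra_simps)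
qed

text \<open>\<open>h + s / 3\<close> is the direction in which the third derivative enters the
  Bregman distance of the cubic Taylor term; the quartic regularizer can therefore dominate that
  term.\<close>

lemma norm_pow4_dominates_cubic:
  fixes h s :: "'a::real_inner"
  shows "norm s ^ 2 * norm (h + (1/3) *\<^sub>R s) ^ 2 \<le> norm (h + s) ^ 4 - norm h ^ 4 - 4 * norm h ^ 2 * (h \<bullet> s)"
proof -
  have "norm (h + (1/3) *\<^sub>R s) ^ 2 = norm h ^ 2 + 2/3 * (h \<bullet> s) + norm s ^ 2 / 9"
    by (simp add: power2_norm_eq_inner inner_add inner_commute)
  moreover have "(h \<bullet> s)\<^sup>2 \<le> norm h ^ 2 * norm s ^ 2"
    using Cauchy_Schwarz_ineq[of h s] by (simp add: power2_norm_eq_inner)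
  moreover have "0 \<le> 5 * ((h \<bullet> s) + norm s ^ 2 / 3) ^ 2 + norm s ^ 4 / 3" by simp
  ultimately show ?thesis unfolding norm_pow4_expand
    by (simp add: power2_eq_square power4_eq_xxxx algebra_simps)
qed

text \<open>Polarization on unit vectors: by the parallelogram law the two diagonal bounds add up to
  \<open>4 * c\<close>, so no constant is lost.\<close>

lemma symmetric_bilinear_bound:
  fixes B :: "'a::real_inner \<Rightarrow>\<^sub>L 'a \<Rightarrow>\<^sub>L real"
  assumes sym: "\<And>a b. B a b = B b a" and diag: "\<And>a. \<bar>B a a\<bar> \<le> c * norm a ^ 2"
  shows "\<bar>B s w\<bar> \<le> c * norm s * norm w"
proof (cases "s = 0 \<or> w = 0")
  case True then show ?thesis by (auto simp: blinfun.bilinear_simps)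
next
  case False
  have unit: "\<bar>B a b\<bar> \<le> c" if "norm a = 1" "norm b = 1" for a b
  proof -
    have "4 * B a b = B (a + b) (a + b) - B (a - b) (a - b)"
      by (simp add: blinfun.bilinear_simps sym[of b a])
    moreover have "\<bar>B (a + b) (a + b)\<bar> \<le> c * norm (a + b) ^ 2"
      "\<bar>B (a - b) (a - b)\<bar> \<le> c * norm (a - b) ^ 2"
      by (rule diag)+
    moreover have "c * norm (a + b) ^ 2 + c * norm (a - b) ^ 2 = c * (2 * norm a ^ 2 + 2 * norm b ^ 2)"
      by (simp add: power2_norm_eq_inner inner_add inner_diff inner_commute algebra_simps)
    ultimately show ?thesis using that by simp
  qed
  have "B s w = norm s * norm w * B (sgn s) (sgn w)"
    using False by (simp add: sgn_div_norm blinfun.bilinear_simps divide_simps)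
  then have "\<bar>B s w\<bar> = norm s * norm w * \<bar>B (sgn s) (sgn w)\<bar>"
    by (simp add: abs_mult)
  also have "\<dots> \<le> norm s * norm w * c"
    using False by (intro mult_left_mono unit) (auto simp: norm_sgn)
  finally show ?thesis by (simp add: mult.commute mult.left_commute)
qed

lemma norm_le_of_inner:
  fixes r :: "'a::real_inner"
  assumes "\<And>w. \<bar>r \<bullet> w\<bar> \<le> c * norm w" and "c \<ge> 0"
  shows "norm r \<le> c"
proof (cases "r = 0")
  case True
  then show ?thesis using assms(2) by simp
next
  case False
  have "norm r * norm r \<le> c * norm r" using assms(1)[of r] by (simp add: dot_square_norm power2_eq_square)
  then show ?thesis using False by simp
qed

text \<open>\<open>norm h ^ 2 *\<^sub>R h\<close> is the gradient of \<open>norm h ^ 4 / 4\<close>;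
  this controls the quartic part of the residual.\<close>

lemma norm_sq_scaled_diff:
  fixes h k :: "'a::real_inner"
  assumes "norm h \<le> D" "norm k \<le> D"
  shows "norm (norm k ^ 2 *\<^sub>R k - norm h ^ 2 *\<^sub>R h) \<le> 3 * D ^ 2 * norm (k - h)"
proof -
  have D: "D \<ge> 0" using assms norm_ge_zero order_trans by blast
  have "norm k ^ 2 *\<^sub>R k - norm h ^ 2 *\<^sub>R h = norm k ^ 2 *\<^sub>R (k - h) + ((norm k - norm h) * (norm k + norm h)) *\<^sub>R h"
    by (simp add: algebra_simps power2_eq_square)
  then have "norm (norm k ^ 2 *\<^sub>R k - norm h ^ 2 *\<^sub>R h) \<le> norm k ^ 2 * norm (k - h) + \<bar>norm k - norm h\<bar> * (norm k + norm h) * norm h"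
    using norm_triangle_ineq[of "norm k ^ 2 *\<^sub>R (k - h)" "((norm k - norm h) * (norm k + norm h)) *\<^sub>R h"]
    by (simp add: abs_mult)
  also have "\<dots> \<le> D ^ 2 * norm (k - h) + norm (k - h) * (D + D) * D"
    using assms D norm_triangle_ineq3[of k h]
    by (intro add_mono mult_mono power_mono mult_nonneg_nonneg add_nonneg_nonneg) auto
  finally show ?thesis by (simp add: power2_eq_square algebra_simps)
qed

section \<open>Convexity and the higher derivatives\<close>

locale convex_lipschitz_third = lipschitz_third +
  assumes convex: "convex_on UNIV f"
begin

lemma tangent_le: "f x + D1 f x (y - x) \<le> f y"
  by (rule convex_tangent_le[OF convex fderiv_has_derivative[OF diff1]])

text \<open>Tangent inequalities from both ends of a segment make the gradient monotone; pass to the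
  limit in its difference quotients.\<close>

lemma D2_nonneg: "D2 f x s s \<ge> 0"
proof -
  have "((\<lambda>y. D1 f y s) has_derivative (\<lambda>h. D2 f x h s)) (at x)"
    by (auto intro!: derivative_eq_intros D2_deriv simp: blinfun.bilinear_simps)
  from has_derivative_directional[OF this, of s]
  have lim: "((\<lambda>t. (D1 f (x + t *\<^sub>R s) s - D1 f x s) /\<^sub>R t) \<longlongrightarrow> D2 f x s s) (at_right 0)" .
  have "0 \<le> (D1 f (x + t *\<^sub>R s) s - D1 f x s) /\<^sub>R t" if "t \<in> {0<..<1}" for t
  proof -
    have "f x + t * D1 f x s \<le> f (x + t *\<^sub>R s)"
      using tangent_le[of x "x + t *\<^sub>R s"] by (simp add: blinfun.bilinear_simps)
    moreover have "f (x + t *\<^sub>R s) - t * D1 f (x + t *\<^sub>R s) s \<le> f x"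
      using tangent_le[of "x + t *\<^sub>R s" x] by (simp add: blinfun.bilinear_simps)
    ultimately have "0 \<le> t * (D1 f (x + t *\<^sub>R s) s - D1 f x s)" by (simp add: algebra_simps)
    then show ?thesis using that by (simp add: zero_le_mult_iff)
  qed
  then show ?thesis
    by (intro tendsto_lowerbound[OF lim] eventually_at_rightI[of 0 1]) auto
qed

text \<open>Positive semidefiniteness of the Hessian at \<open>x \<plusminus> 2 m\<close>, expanded around \<open>x\<close>.\<close>

lemma D3_le_D2: "\<bar>D3 f x m s s\<bar> \<le> D2 f x s s / 2 + 2 * L * norm m ^ 2 * norm s ^ 2"
proof -
  have *: "- D3 f x m s s \<le> D2 f x s s / 2 + 2 * L * norm m ^ 2 * norm s ^ 2" for m
  proof -
    have "\<bar>(D2 f (x + 2 *\<^sub>R m) - D2 f x - D3 f x (2 *\<^sub>R m)) s s\<bar>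
        \<le> norm ((D2 f (x + 2 *\<^sub>R m) - D2 f x - D3 f x (2 *\<^sub>R m)) s) * norm s"
      using norm_blinfun by (metis real_norm_def)
    also have "\<dots> \<le> norm (D2 f (x + 2 *\<^sub>R m) - D2 f x - D3 f x (2 *\<^sub>R m)) * norm s * norm s"
      by (intro mult_right_mono norm_blinfun) auto
    also have "\<dots> \<le> L * norm (2 *\<^sub>R m) ^ 2 * norm s * norm s"
      by (intro mult_right_mono D2_remainder) auto
    finally have "\<bar>D2 f (x + 2 *\<^sub>R m) s s - D2 f x s s - 2 * D3 f x m s s\<bar> \<le> 4 * L * norm m ^ 2 * norm s ^ 2"
      by (simp add: blinfun.bilinear_simps power2_eq_square)
    then show ?thesis using D2_nonneg[of "x + 2 *\<^sub>R m" s] by simp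
  qed
  show ?thesis using *[of m] *[of "- m"] by (simp add: blinfun.bilinear_simps abs_le_iff)
qed

text \<open>\<open>D3_le_D2\<close> controls only the diagonal, whereas the residual is tested
  against arbitrary \<open>w\<close>.\<close>

lemma D3_polarized:
  assumes "\<And>s. D2 f x s s / 2 + 2 * L * norm m ^ 2 * norm s ^ 2 \<le> c * norm s ^ 2"
  shows "\<bar>D3 f x m s w\<bar> \<le> c * norm s * norm w"
  by (rule symmetric_bilinear_bound) (use D3_sym23 D3_le_D2 assms order_trans in blast)+

end

section \<open>The tensor model\<close>

locale tensor_model = convex_lipschitz_third f L for f :: "real^'n \<Rightarrow> real" and L :: real
begin

section \<open>The Hessian matrix and its trace\<close>

lemma grad_f: "grad f x \<bullet> w = D1 f x w"
  by (rule grad_inner[OF fderiv_has_derivative[OF diff1]])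

lemma hessian_inner: "(hessian f x *v w) \<bullet> v = D2 f x w v"
proof -
  have eq: "grad f = (\<lambda>y. \<Sum>b\<in>Basis. D1 f y b *\<^sub>R b)"
  proof
    fix y
    have "grad f y = (\<Sum>b\<in>Basis. (grad f y \<bullet> b) *\<^sub>R b)" by (rule euclidean_representation[symmetric])
    then show "grad f y = (\<Sum>b\<in>Basis. D1 f y b *\<^sub>R b)" by (simp add: grad_f)
  qed
  have der: "(grad f has_derivative (\<lambda>h. \<Sum>b\<in>Basis. D2 f x h b *\<^sub>R b)) (at x)"
    unfolding eq by (auto intro!: derivative_eq_intros D2_deriv simp: blinfun.bilinear_simps)
  then have "(grad f has_derivative (\<lambda>h. hessian f x *v h)) (at x)"
    unfolding hessian_def using jacobian_works differentiable_def by blast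
  from has_derivative_unique[OF this der]
  have "hessian f x *v w = (\<Sum>b\<in>Basis. D2 f x w b *\<^sub>R b)" by metis
  then have "(hessian f x *v w) \<bullet> v = (\<Sum>b\<in>Basis. (v \<bullet> b) * D2 f x w b)"
    by (simp add: inner_sum_right inner_commute[of _ v] mult.commute)
  also have "\<dots> = D2 f x w (\<Sum>b\<in>Basis. (v \<bullet> b) *\<^sub>R b)"
    by (simp add: blinfun.sum_right blinfun.scaleR_right)
  finally show ?thesis by (simp add: euclidean_representation)
qed

lemma trace_hessian: "trace (hessian f x) = (\<Sum>i\<in>UNIV. D2 f x (axis i 1) (axis i 1))"
proof -
  have "hessian f x $ i $ i = D2 f x (axis i 1) (axis i 1)" for i
    by (simp add: hessian_inner[symmetric] inner_axis matrix_vector_mul_component row_def)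
  then show ?thesis by (simp add: trace_def)
qed

text \<open>The largest eigenvalue of a positive semidefinite form is at most its trace.
  Nonnegativity on \<open>s $ j *\<^sub>R axis i 1 - s $ i *\<^sub>R axis j 1\<close> bounds each
  mixed term, without eigenvalues.\<close>

lemma D2_le_trace: "D2 f x s s \<le> trace (hessian f x) * norm s ^ 2"
proof -
  let ?H = "\<lambda>i j. D2 f x (axis i 1) (axis j 1)"
  have s: "s = (\<Sum>i\<in>UNIV. s $ i *\<^sub>R axis i 1)"
    using basis_expansion[of s] by (simp add: scalar_mult_eq_scaleR)
  have "D2 f x s s = D2 f x (\<Sum>i\<in>UNIV. s $ i *\<^sub>R axis i 1) (\<Sum>i\<in>UNIV. s $ i *\<^sub>R axis i 1)"
    using s by simp
  also have "\<dots> = (\<Sum>i\<in>UNIV. \<Sum>j\<in>UNIV. s $ i * s $ j * ?H i j)"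
    by (simp add: blinfun.sum_left blinfun.sum_right blinfun.scaleR_left blinfun.scaleR_right sum_distrib_left mult.assoc D2_sym)
  also have "\<dots> \<le> (\<Sum>i\<in>UNIV. \<Sum>j\<in>UNIV. ((s $ i)\<^sup>2 * ?H j j + (s $ j)\<^sup>2 * ?H i i) / 2)"
  proof (intro sum_mono)
    fix i j
    have "0 \<le> D2 f x (s $ j *\<^sub>R axis i 1 - s $ i *\<^sub>R axis j 1) (s $ j *\<^sub>R axis i 1 - s $ i *\<^sub>R axis j 1)"
      by (rule D2_nonneg)
    then show "s $ i * s $ j * ?H i j \<le> ((s $ i)\<^sup>2 * ?H j j + (s $ j)\<^sup>2 * ?H i i) / 2"
      by (simp add: blinfun.bilinear_simps D2_sym[of x "axis j 1" "axis i 1"] power2_eq_square algebra_simps)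
  qed
  also have "\<dots> = (\<Sum>i\<in>UNIV. (s $ i)\<^sup>2) * (\<Sum>j\<in>UNIV. ?H j j)"
    by (simp add: sum.distrib sum_product add_divide_distrib sum_divide_distrib[symmetric] sum.swap[of "\<lambda>i j. (s $ j)\<^sup>2 * ?H i i"])
  also have "(\<Sum>i\<in>UNIV. (s $ i)\<^sup>2) = norm s ^ 2"
    unfolding power2_norm_eq_inner inner_vec_def by (simp add: power2_eq_square)
  finally show ?thesis by (simp add: trace_hessian mult.commute)
qed

lemma trace_nonneg: "trace (hessian f x) \<ge> 0"
  unfolding trace_hessian by (intro sum_nonneg D2_nonneg)

lemma D2_bilinear_le_trace: "\<bar>D2 f x s w\<bar> \<le> trace (hessian f x) * norm s * norm w"
  by (rule symmetric_bilinear_bound) (use D2_sym D2_le_trace D2_nonneg in auto)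

section \<open>Gradients and Bregman distances of the models\<close>

lemma rho_eq: "rho f x M y = D2 f x (y - x) (y - x) / 2 + M / 8 * norm (y - x) ^ 4"
  by (simp add: rho_def hessian_inner)

lemma quadratic_has_derivative:
  "((\<lambda>y. D2 f x (y - x) (y - x)) has_derivative (\<lambda>w. 2 * D2 f x (y - x) w)) (at y)"
proof -
  have d: "((\<lambda>y. y - x) has_derivative (\<lambda>w. w)) (at y)" by (auto intro!: derivative_eq_intros)
  note d1 = bounded_linear.has_derivative[OF blinfun.bounded_linear_right d, of "D2 f x"]
  have "D2 f x (y - x) w + D2 f x w (y - x) = 2 * D2 f x (y - x) w" for w
    using D2_sym[of x w "y - x"] by simp
  then show ?thesis using blinfun.FDERIV[OF d1 d] by simp
qed

lemma cubic_has_derivative: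
  "((\<lambda>y. D3 f x (y - x) (y - x) (y - x)) has_derivative (\<lambda>w. 3 * D3 f x (y - x) (y - x) w)) (at y)"
proof -
  have d: "((\<lambda>y. y - x) has_derivative (\<lambda>w. w)) (at y)" by (auto intro!: derivative_eq_intros)
  note d1 = bounded_linear.has_derivative[OF blinfun.bounded_linear_right d, of "D3 f x"]
  have "D3 f x (y - x) (y - x) w + (D3 f x (y - x) w + D3 f x w (y - x)) (y - x) = 3 * D3 f x (y - x) (y - x) w" for w
    using D3_sym12[of x w "y - x"] D3_sym23[of x "y - x" w "y - x"] by (simp add: blinfun.add_left)
  then show ?thesis using blinfun.FDERIV[OF blinfun.FDERIV[OF d1 d] d] by simp
qed

lemma Omega_eq: "Omega f x M y = f x + D1 f x (y - x) + 1/2 * D2 f x (y - x) (y - x)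
    + 1/6 * D3 f x (y - x) (y - x) (y - x) + M / 8 * norm (y - x) ^ 4"
  by (simp add: Omega_def taylor3_def Let_def fact_numeral)

lemma rho_has_derivative':
  "(rho f x M has_derivative (\<lambda>w. D2 f x (y - x) w + M / 2 * norm (y - x) ^ 2 * ((y - x) \<bullet> w))) (at y)"
  unfolding rho_eq[abs_def]
  by (rule has_derivative_eq_rhs[OF has_derivative_add[OF
        has_derivative_mult_right[OF quadratic_has_derivative, of "1/2", simplified]
        has_derivative_mult_right[OF norm_pow4_has_derivative]]]) (simp add: mult_ac)

lemma grad_rho:
  "grad (rho f x M) y \<bullet> w = D2 f x (y - x) w + M / 2 * norm (y - x) ^ 2 * ((y - x) \<bullet> w)"
  by (rule grad_inner[OF rho_has_derivative'])

lemma rho_has_derivative: "(rho f x M has_derivative (\<bullet>) (grad (rho f x M) y)) (at y)"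
  by (rule has_derivative_eq_rhs[OF rho_has_derivative']) (simp add: grad_rho fun_eq_iff)

lemma grad_Omega:
  "grad (Omega f x M) y \<bullet> w = D1 f x w + D2 f x (y - x) w + D3 f x (y - x) (y - x) w / 2
     + M / 2 * norm (y - x) ^ 2 * ((y - x) \<bullet> w)"
proof -
  have "((\<lambda>y. D1 f x (y - x)) has_derivative D1 f x) (at y)"
    by (auto intro!: derivative_eq_intros)
  note der = has_derivative_add[OF has_derivative_add[OF has_derivative_add[OF
        has_derivative_add[OF has_derivative_const[of "f x"] this]
        has_derivative_mult_right[OF quadratic_has_derivative, of "1/2"]]
        has_derivative_mult_right[OF cubic_has_derivative, of "1/6"]]
        has_derivative_mult_right[OF norm_pow4_has_derivative, of "M/8"]]
  have "(Omega f x M has_derivative (\<lambda>w. D1 f x w + D2 f x (y - x) w + D3 f x (y - x) (y - x) w / 2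
     + M / 2 * norm (y - x) ^ 2 * ((y - x) \<bullet> w))) (at y)"
    unfolding Omega_eq[abs_def] by (rule has_derivative_eq_rhs[OF der]) (auto simp: mult_ac)
  then show ?thesis by (rule grad_inner)
qed

lemma grad_Omega_center: "grad (Omega f x M) x = grad f x"
  by (rule vector_eq_rdot[THEN iffD1]) (simp add: grad_Omega grad_f)

lemma bregman_rho:
  "bregman (rho f x M) u v = D2 f x (v - u) (v - u) / 2
     + M / 8 * (norm (v - x) ^ 4 - norm (u - x) ^ 4 - 4 * norm (u - x) ^ 2 * ((u - x) \<bullet> (v - u)))"
proof -
  define h s where "h = u - x" and "s = v - u"
  have v: "v - x = h + s" by (simp add: h_def s_def)
  show ?thesis
    unfolding bregman_def grad_rho unfolding rho_eq v h_def[symmetric] s_def[symmetric]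
    by (simp add: blinfun.bilinear_simps D2_sym[of x s h] algebra_simps)
qed

text \<open>Write \<open>h = u - x\<close> and \<open>s = v - u\<close>. By full symmetry the cubic
  contributes \<open>(3 D3[h,s,s] + D3[s,s,s]) / 6\<close>, which is
  \<open>D3[h + s/3, s, s] / 2\<close>.\<close>

lemma bregman_Omega:
  "bregman (Omega f x M) u v = bregman (rho f x M) u v
     + D3 f x ((u - x) + (1/3) *\<^sub>R (v - u)) (v - u) (v - u) / 2"
proof -
  define h s where "h = u - x" and "s = v - u"
  have v: "v - x = h + s" by (simp add: h_def s_def)
  show ?thesis
    unfolding bregman_rho unfolding bregman_def grad_Omega
    unfolding Omega_eq v h_def[symmetric] s_def[symmetric]
    by (simp add: blinfun.bilinear_simps D2_sym[of x s h] D3_sym12[of x s h] D3_sym23[of x h s h]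
        D3_sym23[of x s s h] field_simps)
qed

lemma bregman_rho_lower:
  assumes "M \<ge> 0"
  shows "M / 24 * norm (v - u) ^ 4 \<le> bregman (rho f x M) u v"
proof -
  have "M / 24 * norm (v - u) ^ 4 \<le> M / 24 * (3 * (norm (v - x) ^ 4 - norm (u - x) ^ 4 - 4 * norm (u - x) ^ 2 * ((u - x) \<bullet> (v - u))))"
    using norm_pow4_uniformly_convex[of "v - u" "u - x"] assms by (intro mult_left_mono) auto
  then show ?thesis unfolding bregman_rho using D2_nonneg[of x "v - u"] by (simp add: algebra_simps)
qed

lemma bregman_rho_nonneg: "M \<ge> 0 \<Longrightarrow> 0 \<le> bregman (rho f x M) u v"
  by (rule order_trans[OF _ bregman_rho_lower]) auto

text \<open>Relative smoothness 3/2 and relative strong convexity 1/2 in one inequality. Half the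
  bound of \<open>D3_le_D2\<close> leaves a term with factor \<open>L\<close>, paid for by
  \<open>M / 16\<close> times the quartic Bregman distance; hence the threshold
  \<open>16 * L\<close>.\<close>

lemma bregman_Omega_rho:
  assumes "M \<ge> 16 * L"
  shows "\<bar>bregman (Omega f x M) u v - bregman (rho f x M) u v\<bar> \<le> bregman (rho f x M) u v / 2"
proof -
  let ?m = "(u - x) + (1/3) *\<^sub>R (v - u)"
  let ?q = "norm (v - x) ^ 4 - norm (u - x) ^ 4 - 4 * norm (u - x) ^ 2 * ((u - x) \<bullet> (v - u))"
  have "norm (v - u) ^ 2 * norm ?m ^ 2 \<le> ?q"
    using norm_pow4_dominates_cubic[of "v - u" "u - x"] by simp
  then have "16 * L * (norm (v - u) ^ 2 * norm ?m ^ 2) \<le> M * ?q"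
    using assms L_nonneg by (intro mult_mono) auto
  then show ?thesis
    using D3_le_D2[of x ?m "v - u"] unfolding bregman_Omega bregman_rho by (simp add: algebra_simps)
qed

text \<open>\<open>Omega\<close> and \<open>rho\<close> share their quadratic and quartic parts, so
  the residual is the increment of the cubic gradient minus twice that of
  \<open>grad (rho f x M)\<close>. The same factor bounds each of the three increments.\<close>

lemma residual_bound:
  assumes M: "M \<ge> 16 * L" and y: "norm (y - x) \<le> D" "norm (y' - x) \<le> D"
  shows "residual f x M y y' \<le> 3 * (trace (hessian f x) + 3 * M / 2 * D ^ 2) * norm (y' - y)"
proof -
  define s where "s = y' - y"
  \<comment> \<open>\<open>m\<close> is the midpoint of \<open>y - x\<close> and
    \<open>y' - x\<close>; the cubic gradient changes by exactly \<open>D3 f x m s\<close>.\<close>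
  define m where "m = (y - x) + (1/2) *\<^sub>R s"
  define q where "q = norm (y' - x) ^ 2 *\<^sub>R (y' - x) - norm (y - x) ^ 2 *\<^sub>R (y - x)"
  define c where "c = trace (hessian f x) + 3 * M / 2 * D ^ 2"
  have M0: "M \<ge> 0" using M L_nonneg by linarith
  have D: "D \<ge> 0" using y norm_ge_zero order_trans by blast
  have "m = (1/2) *\<^sub>R (y - x) + (1/2) *\<^sub>R (y' - x)"
    unfolding m_def s_def by (simp add: vec_eq_iff field_simps)
  then have "norm m \<le> (1/2) * norm (y - x) + (1/2) * norm (y' - x)"
    using norm_triangle_ineq[of "(1/2) *\<^sub>R (y - x)" "(1/2) *\<^sub>R (y' - x)"] by simp
  then have m: "norm m \<le> D" using y by simp
  have cub: "\<bar>D3 f x m s w\<bar> \<le> c * norm s * norm w" for w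
  proof (rule D3_polarized)
    fix s :: "real^'n"
    have "16 * L * (norm m ^ 2 * norm s ^ 2) \<le> M * (D ^ 2 * norm s ^ 2)"
      using M L_nonneg m D by (intro mult_mono power_mono) auto
    moreover have "0 \<le> trace (hessian f x) * norm s ^ 2" using trace_nonneg by simp
    moreover have "0 \<le> M * (D ^ 2 * norm s ^ 2)" using M0 by simp
    ultimately show "D2 f x s s / 2 + 2 * L * norm m ^ 2 * norm s ^ 2 \<le> c * norm s ^ 2"
      using D2_le_trace[of x s] unfolding c_def by (simp add: algebra_simps)
  qed
  have "\<bar>(grad (Omega f x M) y' + g_psi f x M y y') \<bullet> w\<bar> \<le> 3 * c * norm s * norm w" for w
  proof -
    have q: "\<bar>q \<bullet> w\<bar> \<le> 3 * D ^ 2 * norm s * norm w"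
    proof -
      have "norm q \<le> 3 * D ^ 2 * norm s"
        using norm_sq_scaled_diff[OF y] by (simp add: q_def s_def)
      then have "norm q * norm w \<le> 3 * D ^ 2 * norm s * norm w" by (rule mult_right_mono) simp
      then show ?thesis using Cauchy_Schwarz_ineq2[of q w] by linarith
    qed
    have tri: "\<bar>a - 2 * (b + d)\<bar> \<le> A + 2 * (B + C)" if "\<bar>a\<bar> \<le> A" "\<bar>b\<bar> \<le> B" "\<bar>d\<bar> \<le> C"
      for a b d A B C :: real using that unfolding abs_le_iff by auto
    define h where "h = y - x"
    have y': "y' - x = h + s" by (simp add: s_def h_def)
    have eq: "(grad (Omega f x M) y' + g_psi f x M y y') \<bullet> w
      = D3 f x m s w - 2 * (D2 f x s w + M / 2 * (q \<bullet> w))"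
      unfolding g_psi_def q_def m_def inner_add_left inner_diff_left inner_minus_left inner_scaleR_left grad_Omega grad_rho
      unfolding y' h_def[symmetric]
      by (simp add: blinfun.bilinear_simps inner_add_left inner_diff_left D3_sym12[of x s h] field_simps)
    have "\<bar>M / 2 * (q \<bullet> w)\<bar> \<le> M / 2 * (3 * D ^ 2 * norm s * norm w)"
      using M0 q by (simp add: abs_mult mult_left_mono)
    then have "\<bar>(grad (Omega f x M) y' + g_psi f x M y y') \<bullet> w\<bar>
       \<le> c * norm s * norm w + 2 * (trace (hessian f x) * norm s * norm w + M / 2 * (3 * D ^ 2 * norm s * norm w))"
      unfolding eq by (intro tri cub D2_bilinear_le_trace)
    then show ?thesis unfolding c_def by (simp add: algebra_simps)
  qed
  then show ?thesis unfolding residual_def s_def[symmetric] c_def[symmetric]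
    by (rule norm_le_of_inner) (use M0 trace_nonneg in \<open>simp add: c_def\<close>)
qed

end

section \<open>The inner iteration\<close>

lemma powr_third:
  fixes c :: real
  assumes "c \<ge> 0"
  shows "(c powr (1/3)) ^ 2 = c powr (2/3)" "(c powr (1/3)) ^ 3 = c" "(c powr (1/3)) ^ 4 = c powr (4/3)"
  using assms by (cases "c = 0"; simp add: powr_power)+

text \<open>Compare with points on the segment towards \<open>u\<close>: convexity bounds the change
  of \<open>p\<close> linearly in \<open>t\<close>, and \<open>t\<close> tending to 0 leaves the
  derivative of \<open>q\<close>.\<close>

lemma composite_minimizer_variational:
  fixes p q :: "'a::real_normed_vector \<Rightarrow> real"
  assumes p: "convex_on D p" and q: "(q has_derivative q') (at y)" and y: "y \<in> D" and u: "u \<in> D"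
    and min: "\<And>w. w \<in> D \<Longrightarrow> q y + p y \<le> q w + p w"
  shows "p y \<le> p u + q' (u - y)"
proof -
  have "p y - p u \<le> (q (y + t *\<^sub>R (u - y)) - q y) /\<^sub>R t" if t: "t \<in> {0<..<1}" for t
  proof -
    have eq: "(1 - t) *\<^sub>R y + t *\<^sub>R u = y + t *\<^sub>R (u - y)" by (simp add: algebra_simps)
    have "(1 - t) *\<^sub>R y + t *\<^sub>R u \<in> D"
      using convexD_alt[OF convex_on_imp_convex[OF p] y u] t by simp
    then have "q y + p y \<le> q (y + t *\<^sub>R (u - y)) + p ((1 - t) *\<^sub>R y + t *\<^sub>R u)"
      using min unfolding eq by simp
    also have "p ((1 - t) *\<^sub>R y + t *\<^sub>R u) \<le> (1 - t) * p y + t * p u"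
      using convex_onD[OF p] t y u by auto
    finally show ?thesis using t by (simp add: field_simps)
  qed
  then have "p y - p u \<le> q' (u - y)"
    by (intro tendsto_lowerbound[OF has_derivative_directional[OF q]] eventually_at_rightI[of 0 1]) auto
  then show ?thesis by simp
qed

locale composite_model = tensor_model f L for f :: "real^'n \<Rightarrow> real" and L :: real +
  fixes \<psi> :: "real^'n \<Rightarrow> ereal"
  assumes psi_not_MInf: "\<And>x. \<psi> x \<noteq> - \<infinity>" and psi_convex: "econvex \<psi>"
begin

text \<open>Real-valued form of \<psi>, faithful on \<open>edom\<close>; it is 0 where \<psi> is
  infinite.\<close>

definition p :: "real^'n \<Rightarrow> real" where "p x = real_of_ereal (\<psi> x)"

lemma psi_eq: "x \<in> edom \<psi> \<Longrightarrow> \<psi> x = ereal (p x)"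
  using psi_not_MInf[of x] by (cases "\<psi> x") (auto simp: edom_def p_def)

lemma psi_outside: "x \<notin> edom \<psi> \<Longrightarrow> \<psi> x = \<infinity>"
  by (auto simp: edom_def)

lemma edom_convex_combination:
  assumes "x \<in> edom \<psi>" "y \<in> edom \<psi>" "0 \<le> u" "u \<le> 1"
  shows "(1 - u) *\<^sub>R x + u *\<^sub>R y \<in> edom \<psi> \<and> p ((1 - u) *\<^sub>R x + u *\<^sub>R y) \<le> (1 - u) * p x + u * p y"
proof (cases "u = 0 \<or> u = 1")
  case True then show ?thesis using assms by auto
next
  case False
  then have "u \<in> {0<..<1}" using assms by auto
  then have le: "\<psi> ((1 - u) *\<^sub>R x + u *\<^sub>R y) \<le> ereal ((1 - u) * p x + u * p y)"
    using psi_convex[unfolded econvex_def, rule_format, of u x y] assms(1,2) by (simp add: psi_eq)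
  then have "(1 - u) *\<^sub>R x + u *\<^sub>R y \<in> edom \<psi>" unfolding edom_def by auto
  then show ?thesis using le by (simp add: psi_eq)
qed

lemma p_convex: "convex_on (edom \<psi>) p"
proof (rule convex_onI)
  show "convex (edom \<psi>)" unfolding convex_alt using edom_convex_combination by blast
qed (use edom_convex_combination in auto)

lemma subdiff_iff: "g \<in> subdiff \<psi> x \<longleftrightarrow> x \<in> edom \<psi> \<and> (\<forall>y\<in>edom \<psi>. p x + g \<bullet> (y - x) \<le> p y)"
proof -
  have "\<psi> x + ereal (g \<bullet> (y - x)) \<le> \<psi> y \<longleftrightarrow> (y \<in> edom \<psi> \<longrightarrow> p x + g \<bullet> (y - x) \<le> p y)" if "x \<in> edom \<psi>" for y
    using that by (cases "y \<in> edom \<psi>") (auto simp: psi_eq psi_outside)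
  then show ?thesis unfolding subdiff_def by auto
qed

text \<open>The differentiable part of the subproblem has gradient \<open>- g_psi f x M y y'\<close>
  at \<open>y'\<close>. The nonempty domain rules out a minimizer of infinite value.\<close>

lemma inner_iterate_optimality:
  assumes it: "inner_iterate f \<psi> x M y y'" and ne: "edom \<psi> \<noteq> {}"
  shows "g_psi f x M y y' \<in> subdiff \<psi> y'"
proof -
  define q where "q = (\<lambda>u. grad (Omega f x M) y \<bullet> (u - y) + 3 * bregman (rho f x M) y u)"
  have min: "\<not> (ereal (q u) + \<psi> u < ereal (q y') + \<psi> y')" for u
    using it unfolding inner_iterate_def is_arg_min_def q_def by blast
  obtain w where w: "w \<in> edom \<psi>" using ne by blast
  have y': "y' \<in> edom \<psi>"
  proof (rule ccontr)
    assume "y' \<notin> edom \<psi>"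
    then show False using min[of w] w by (simp add: psi_outside psi_eq)
  qed
  have min': "q y' + p y' \<le> q u + p u" if "u \<in> edom \<psi>" for u
    using min[of u] that y' by (simp add: psi_eq)
  have der: "(q has_derivative (\<lambda>h. grad (Omega f x M) y \<bullet> h + 3 * (grad (rho f x M) y' \<bullet> h - grad (rho f x M) y \<bullet> h))) (at y')"
    unfolding q_def bregman_def
    by (auto intro!: derivative_eq_intros rho_has_derivative)
  have "p y' + g_psi f x M y y' \<bullet> (u - y') \<le> p u" if "u \<in> edom \<psi>" for u
    using composite_minimizer_variational[OF p_convex der y' that min']
    by (simp add: g_psi_def inner_add_left inner_diff_left inner_diff_right algebra_simps)
  then show ?thesis using y' by (simp add: subdiff_iff)
qed

lemma inner_iterate_edom: "inner_iterate f \<psi> x M y y' \<Longrightarrow> edom \<psi> \<noteq> {} \<Longrightarrow> y' \<in> edom \<psi>"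
  using inner_iterate_optimality subdiff_iff by blast

text \<open>Combines smoothness from \<open>y\<close> to \<open>y'\<close>, strong convexity from
  \<open>y\<close> to \<open>u\<close> and the subgradient at \<open>y'\<close> through the
  three-point identity. The weight 3 covers the smoothness constant 3/2, and
  \<open>5/2 = 3 - 1/2\<close>.\<close>

lemma inner_descent:
  assumes it: "inner_iterate f \<psi> x M y y'" and u: "u \<in> edom \<psi>" and M: "M \<ge> 16 * L"
  shows "Omega f x M y' + p y' + 3 * bregman (rho f x M) y' u
    \<le> Omega f x M u + p u + 5/2 * bregman (rho f x M) y u"
proof -
  let ?b = "bregman (rho f x M)"
  have M0: "M \<ge> 0" using M L_nonneg by linarith
  have "Omega f x M y' \<le> Omega f x M y + grad (Omega f x M) y \<bullet> (y' - y) + 3/2 * ?b y y'"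
    using bregman_Omega_rho[OF M, of x y y'] unfolding bregman_def[of "Omega f x M"] by linarith
  moreover have "Omega f x M y + grad (Omega f x M) y \<bullet> (u - y) + 1/2 * ?b y u \<le> Omega f x M u"
    using bregman_Omega_rho[OF M, of x y u] unfolding bregman_def[of "Omega f x M"] by linarith
  moreover have "p y' + g_psi f x M y y' \<bullet> (u - y') \<le> p u"
    using inner_iterate_optimality[OF it] u subdiff_iff by blast
  moreover have "g_psi f x M y y' \<bullet> (u - y') = - (grad (Omega f x M) y \<bullet> (u - y)) + grad (Omega f x M) y \<bullet> (y' - y)
      - 3 * (?b y u - ?b y' u - ?b y y')"
    by (simp add: g_psi_def bregman_def inner_add_left inner_diff_left inner_diff_right algebra_simps)
  moreover have "0 \<le> ?b y y'" by (rule bregman_rho_nonneg[OF M0])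
  moreover have "Oy' + py' + 3 * byu' \<le> Ou + pu + 5/2 * byu"
    if "Oy' \<le> Oy + a + 3/2 * byy" "Oy + b + 1/2 * byu \<le> Ou" "py' + g \<le> pu"
      "g = - b + a - 3 * (byu - byu' - byy)" "0 \<le> byy" for Oy' Oy Ou py' pu a b g byu byu' byy :: real
    using that by argo
  ultimately show ?thesis by blast
qed

text \<open>The last iterate has the smallest model value, so \<open>inner_descent\<close> with
  \<open>u = ys K\<close> contracts by \<open>(5/2) / 3 = 5/6\<close>.\<close>

lemma inner_contraction:
  assumes M: "M \<ge> 16 * L" and y0: "ys 0 \<in> edom \<psi>"
    and it: "\<And>j. j < K \<Longrightarrow> inner_iterate f \<psi> x M (ys j) (ys (Suc j))"
  shows "j \<le> K \<Longrightarrow> Omega f x M (ys K) + p (ys K) \<le> Omega f x M (ys j) + p (ys j)"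
    and "j \<le> K \<Longrightarrow> bregman (rho f x M) (ys j) (ys K) \<le> (5/6) ^ j * bregman (rho f x M) (ys 0) (ys K)"
proof -
  have M0: "M \<ge> 0" using M L_nonneg by linarith
  have dom: "ys j \<in> edom \<psi>" if "j \<le> K" for j
  proof (cases j)
    case (Suc i)
    then show ?thesis using inner_iterate_edom[OF it[of i]] that y0 by auto
  qed (use y0 in simp)
  have dec: "Omega f x M (ys (Suc j)) + p (ys (Suc j)) \<le> Omega f x M (ys j) + p (ys j)" if "j < K" for j
    using inner_descent[OF it[OF that] dom[of j] M] that bregman_rho_nonneg[OF M0, of x "ys (Suc j)" "ys j"]
    by (simp add: bregman_def[of _ "ys j" "ys j"])
  show mono: "Omega f x M (ys K) + p (ys K) \<le> Omega f x M (ys j) + p (ys j)" if "j \<le> K" for j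
    using that by (induction rule: inc_induct) (use dec order_trans in blast)+
  show "bregman (rho f x M) (ys j) (ys K) \<le> (5/6) ^ j * bregman (rho f x M) (ys 0) (ys K)" if "j \<le> K"
    using that
  proof (induction j)
    case (Suc j)
    then have "bregman (rho f x M) (ys (Suc j)) (ys K) \<le> 5/6 * bregman (rho f x M) (ys j) (ys K)"
      using inner_descent[OF it[of j] dom[of K] M] mono[of "Suc j"] by linarith
    also have "\<dots> \<le> 5/6 * ((5/6) ^ j * bregman (rho f x M) (ys 0) (ys K))"
      using Suc by (intro mult_left_mono) auto
    finally show ?case by simp
  qed simp
qed

text \<open>\<open>G\<close> is a subgradient of the regularized model at its center; relative
  strong convexity 1/2 and the term \<open>M / 8\<close> of \<open>rho\<close> give
  \<open>M / 16\<close>.\<close>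

lemma inner_radius:
  assumes M: "M \<ge> 16 * L" "M > 0" and G: "G \<in> subdiff_composite f \<psi> x" and y: "y \<in> edom \<psi>"
    and le: "Omega f x M y + p y \<le> Omega f x M x + p x"
  shows "M / 16 * norm (y - x) ^ 3 \<le> norm G"
proof -
  obtain g where g: "g \<in> subdiff \<psi> x" "G = grad f x + g" using G by (auto simp: subdiff_composite_def)
  have "Omega f x M x + grad f x \<bullet> (y - x) + 1/2 * bregman (rho f x M) x y \<le> Omega f x M y"
    using bregman_Omega_rho[OF M(1), of x x y] unfolding bregman_def[of "Omega f x M"] grad_Omega_center by linarith
  moreover have "p x + g \<bullet> (y - x) \<le> p y" using g y subdiff_iff by blast
  moreover have "M / 8 * norm (y - x) ^ 4 \<le> bregman (rho f x M) x y"
    unfolding bregman_rho using D2_nonneg[of x "y - x"] by simp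
  moreover have "- (G \<bullet> (y - x)) \<le> norm G * norm (y - x)"
    using Cauchy_Schwarz_ineq2[of G "y - x"] by linarith
  ultimately have "M / 16 * norm (y - x) ^ 4 \<le> norm G * norm (y - x)"
    using le g(2) by (simp add: inner_add_left)
  then have *: "norm (y - x) * (M / 16 * norm (y - x) ^ 3) \<le> norm (y - x) * norm G"
    by (simp add: power4_eq_xxxx power3_eq_cube mult_ac)
  then show ?thesis by (cases "y = x") auto
qed

text \<open>\<open>inner_contraction\<close> makes the last step geometrically small and
  \<open>residual_bound\<close> turns its length into a residual, within the failure
  threshold.\<close>

lemma no_failure:
  assumes M: "M \<ge> 16 * L" "M > 0" and G: "G \<in> subdiff_composite f \<psi> x"
    and y0: "ys 0 = x" and it: "\<And>j. j \<le> k \<Longrightarrow> inner_iterate f \<psi> x M (ys j) (ys (Suc j))"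
  shows "inner_verdict f \<epsilon> x G M k (ys k) (ys (Suc k)) \<noteq> Failure"
proof -
  \<comment> \<open>\<open>D\<close> is the radius behind both constants of Algorithm 1:
    \<open>L_const\<close> is the bracket of \<open>residual_bound\<close>, and
    \<open>beta_const\<close> bounds the initial Bregman distance. \<open>inner_radius\<close> gives
    16 in place of 96, so all iterates fit.\<close>
  define D where "D = (96 * norm G / M) powr (1/3)"
  have D0: "D \<ge> 0" by (simp add: D_def)
  have base: "96 * norm G / M \<ge> 0" using M by simp
  have D2: "(96 * norm G / M) powr (2/3) = D ^ 2" and D3: "96 * norm G / M = D ^ 3"
    and D4: "(96 * norm G / M) powr (4/3) = D ^ 4"
    unfolding D_def using powr_third[OF base] by simp_all
  have xdom: "x \<in> edom \<psi>" using G by (auto simp: subdiff_composite_def subdiff_iff)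
  define L' where "L' = L_const f x G M"
  define b where "b = beta_const f x G M"
  have L': "L' = trace (hessian f x) + 3 * M / 2 * D ^ 2" and b: "b = 1/2 * trace (hessian f x) * D ^ 2 + M / 8 * D ^ 4"
    unfolding L'_def b_def L_const_def beta_const_def D2 D4 by simp_all
  have dom: "ys j \<in> edom \<psi>" if "j \<le> Suc k" for j
  proof (cases j)
    case (Suc i)
    then show ?thesis using inner_iterate_edom[OF it[of i]] that xdom by auto
  qed (use y0 xdom in simp)
  have rad: "norm (ys j - x) \<le> D" if "j \<le> Suc k" for j
  proof -
    have "Omega f x M (ys j) + p (ys j) \<le> Omega f x M (ys 0) + p (ys 0)"
      by (rule inner_contraction(1)[OF M(1)]) (use that y0 xdom it in auto)
    then have "M / 16 * norm (ys j - x) ^ 3 \<le> norm G"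
      using inner_radius[OF M G dom[OF that]] y0 by simp
    then have "norm (ys j - x) ^ 3 \<le> 16 * norm G / M" using M by (simp add: field_simps)
    also have "\<dots> \<le> D ^ 3" unfolding D3[symmetric] using M by (intro divide_right_mono) auto
    finally show ?thesis using D0 by (simp add: power_mono_iff)
  qed
  define s where "s = norm (ys (Suc k) - ys k)"
  define r where "r = residual f x M (ys k) (ys (Suc k))"
  have "bregman (rho f x M) x (ys (Suc k)) \<le> b"
  proof -
    have "D2 f x (ys (Suc k) - x) (ys (Suc k) - x) \<le> trace (hessian f x) * norm (ys (Suc k) - x) ^ 2"
      by (rule D2_le_trace)
    also have "\<dots> \<le> trace (hessian f x) * D ^ 2"
      using rad[of "Suc k"] trace_nonneg by (intro mult_left_mono power_mono) auto
    finally have "D2 f x (ys (Suc k) - x) (ys (Suc k) - x) \<le> trace (hessian f x) * D ^ 2" .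
    moreover have "M / 8 * norm (ys (Suc k) - x) ^ 4 \<le> M / 8 * D ^ 4"
      using rad[of "Suc k"] M by (intro mult_left_mono power_mono) auto
    ultimately show ?thesis unfolding b bregman_rho by simp
  qed
  moreover have "bregman (rho f x M) (ys k) (ys (Suc k)) \<le> (5/6) ^ k * bregman (rho f x M) (ys 0) (ys (Suc k))"
    by (rule inner_contraction(2)[OF M(1)]) (use y0 xdom it in auto)
  moreover have "M / 24 * s ^ 4 \<le> bregman (rho f x M) (ys k) (ys (Suc k))"
    unfolding s_def using bregman_rho_lower M by simp
  moreover have "(5/6) ^ k * bregman (rho f x M) (ys 0) (ys (Suc k)) \<le> (5/6) ^ k * b"
    using calculation(1) y0 by (intro mult_left_mono) auto
  ultimately have "M / 24 * s ^ 4 \<le> (5/6) ^ k * b" by linarith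
  then have "M * s ^ 4 \<le> 24 * ((5/6) ^ k * b)" by simp
  then have "s ^ 4 \<le> 24 * ((5/6) ^ k * b) / M"
    using M by (simp add: pos_le_divide_eq mult.commute)
  also have "\<dots> = 24 * b / (M * (6/5) ^ k)" by (simp add: power_divide mult_ac)
  finally have s4: "s ^ 4 \<le> 24 * b / (M * (6/5) ^ k)" .
  have r0: "r \<ge> 0" by (simp add: r_def residual_def)
  have "r \<le> 3 * L' * s"
    unfolding r_def L' s_def by (rule residual_bound) (use M rad in auto)
  then have "r ^ 4 \<le> (3 * L' * s) ^ 4" using r0 by (rule power_mono)
  also have "\<dots> = 81 * L' ^ 4 * s ^ 4" by (simp add: power_mult_distrib)
  also have "\<dots> \<le> 81 * L' ^ 4 * (24 * b / (M * (6/5) ^ k))" using s4 by (intro mult_left_mono) auto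
  also have "\<dots> \<le> 3 ^ 8 * L' ^ 4 * b / (2 * M * (6/5) ^ k)"
  proof -
    have "b \<ge> 0" unfolding b using M trace_nonneg D0 by simp
    then have X: "0 \<le> L' ^ 4 * b / (M * (6/5) ^ k)" (is "0 \<le> ?X") using M by simp
    \<comment> \<open>The estimates yield 1944, below the \<open>3 ^ 8 / 2 = 3280.5\<close> of the
      failure test.\<close>
    have "81 * L' ^ 4 * (24 * b / (M * (6/5) ^ k)) = 1944 * ?X" by simp
    also have "\<dots> \<le> (3 ^ 8 / 2) * ?X" using X by simp
    also have "\<dots> = 3 ^ 8 * L' ^ 4 * b / (2 * M * (6/5) ^ k)" by simp
    finally show ?thesis .
  qed
  finally have "\<not> r ^ 4 > 3 ^ 8 * L_const f x G M ^ 4 * beta_const f x G M / (2 * M * (6/5) ^ k)"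
    unfolding L'_def b_def by simp
  then show ?thesis unfolding inner_verdict_def Let_def r_def[symmetric] by simp
qed

text \<open>\<open>Gp\<close> splits into the model residual \<open>R\<close>, the Taylor error
  \<open>E\<close> and the quartic gradient. \<open>R\<close> and \<open>E\<close> together stay
  below \<open>M / 3 * d ^ 3\<close>, so the quartic part with coefficient \<open>M / 2\<close>
  leaves \<open>M / 6 * d ^ 4\<close> in the inner product.\<close>

lemma success_decrease:
  assumes M: "M \<ge> 16 * L" "M > 0" and eps: "\<epsilon> > 0"
    and succ: "inner_verdict f \<epsilon> x G M k y y' = Success"
    and Gp: "Gp = grad f y' + g_psi f x M y y'" and big: "norm Gp > \<epsilon>"
  shows "sufficient_decrease M x y' Gp"
proof -
  define h where "h = y' - x"
  define d where "d = norm h"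
  define R where "R = grad (Omega f x M) y' + g_psi f x M y y'"
  define E where "E = Gp + (M / 2 * d ^ 2) *\<^sub>R h - R"
  have d0: "d \<ge> 0" by (simp add: d_def)
  have rem: "norm (D1 f y' - D1 f x - D2 f x h - (1/2) *\<^sub>R D3 f x h h) \<le> L * d ^ 3"
    using D1_remainder[of x h] unfolding d_def h_def by simp
  have E: "norm E \<le> M / 16 * d ^ 3"
  proof (rule norm_le_of_inner)
    fix w
    have "E \<bullet> w = (D1 f y' - D1 f x - D2 f x h - (1/2) *\<^sub>R D3 f x h h) w"
      unfolding E_def R_def Gp inner_add_left inner_diff_left grad_Omega grad_f d_def h_def[symmetric]
      by (simp add: blinfun.diff_left blinfun.scaleR_left)
    also have "\<bar>\<dots>\<bar> \<le> norm (D1 f y' - D1 f x - D2 f x h - (1/2) *\<^sub>R D3 f x h h) * norm w"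
      using norm_blinfun by (metis real_norm_def)
    also have "\<dots> \<le> L * d ^ 3 * norm w" using rem by (intro mult_right_mono) auto
    also have "\<dots> \<le> M / 16 * d ^ 3 * norm w" using M d0 by (intro mult_right_mono) auto
    finally show "\<bar>E \<bullet> w\<bar> \<le> M / 16 * d ^ 3 * norm w" .
  qed (use M d0 in simp)
  have GpE: "Gp = R + E - (M / 2 * d ^ 2) *\<^sub>R h" by (simp add: E_def)
  have nGp: "norm Gp \<le> norm R + norm E + M / 2 * d ^ 3"
  proof -
    have "norm Gp \<le> norm (R + E) + norm ((M / 2 * d ^ 2) *\<^sub>R h)" unfolding GpE by (rule norm_triangle_ineq4)
    also have "norm ((M / 2 * d ^ 2) *\<^sub>R h) = M / 2 * d ^ 3"
      using M by (simp add: d_def power2_eq_square power3_eq_cube)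
    finally show ?thesis using norm_triangle_ineq[of R E] by simp
  qed
  have "norm R \<le> \<epsilon> / 7 \<or> norm R \<le> M / 6 * d ^ 3"
    using succ unfolding inner_verdict_def Let_def residual_def R_def d_def h_def
    by (auto split: if_splits)
  then have R: "norm R \<le> M / 6 * d ^ 3"
  proof
    \<comment> \<open>Since \<open>\<epsilon> < norm Gp\<close>, this gives
      \<open>7 * norm R \<le> norm R + 9/16 * M * d ^ 3\<close>: the absolute test implies the
      relative one.\<close>
    assume "norm R \<le> \<epsilon> / 7"
    moreover have "0 \<le> M * d ^ 3" using M d0 by simp
    ultimately show ?thesis using nGp E big by simp
  qed
  have Gpd: "norm Gp \<le> M * d ^ 3"
  proof -
    have "0 \<le> M * d ^ 3" using M d0 by simp
    then show ?thesis using nGp E R by simp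
  qed
  have d: "d > 0" using Gpd eps big d0 by (cases "d = 0") auto
  have "M / 6 * d ^ 4 \<le> Gp \<bullet> (x - y')"
  proof -
    have "Gp \<bullet> (x - y') = M / 2 * d ^ 2 * (h \<bullet> h) - (R + E) \<bullet> h"
    proof -
      have "x - y' = - h" by (simp add: h_def)
      then show ?thesis unfolding GpE by (simp add: inner_diff_left)
    qed
    also have "h \<bullet> h = d ^ 2" by (simp add: d_def power2_norm_eq_inner)
    finally have "Gp \<bullet> (x - y') = M / 2 * d ^ 4 - (R + E) \<bullet> h" by (simp flip: power_add)
    moreover have "(R + E) \<bullet> h \<le> norm (R + E) * d" unfolding d_def by (rule norm_cauchy_schwarz)
    moreover have "norm (R + E) * d \<le> (M / 3 * d ^ 3) * d"
    proof (rule mult_right_mono)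
      have "0 \<le> M * d ^ 3" using M d0 by simp
      then show "norm (R + E) \<le> M / 3 * d ^ 3" using norm_triangle_ineq[of R E] R E by linarith
    qed (rule d0)
    moreover have "(M / 3 * d ^ 3) * d = M / 3 * d ^ 4" by (simp add: power3_eq_cube power4_eq_xxxx)
    ultimately show ?thesis by linarith
  qed
  moreover have "1 / (6 * M powr (1/3)) * norm Gp powr (4/3) \<le> M / 6 * d ^ 4"
  proof -
    have "norm Gp powr (4/3) \<le> (M * d ^ 3) powr (4/3)" using Gpd by (intro powr_mono2) auto
    also have "\<dots> = M powr (4/3) * (d ^ 3) powr (4/3)" by (rule powr_mult)
    also have "M powr (4/3) = M * M powr (1/3)" using powr_mult_base[of M "1/3"] M by simp
    also have "(d ^ 3) powr (4/3) = d ^ 4" using powr_powr[of d 3 "4/3"] d by simp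
    finally show ?thesis using M by (simp add: field_simps)
  qed
  ultimately show ?thesis unfolding sufficient_decrease_def by linarith
qed

end

section \<open>The estimating functions\<close>

text \<open>Inequality of means for \<open>u\<close> and three copies of \<open>k\<close>; equality
  at \<open>u = k\<close> produces the double root.\<close>

lemma am_gm_one_three:
  fixes u k :: real
  assumes "u \<ge> 0" "k \<ge> 0"
  shows "256 * u * k ^ 3 \<le> (u + 3 * k) ^ 4"
proof -
  have "(u + 3 * k) ^ 4 - 256 * u * k ^ 3 = (u - k)\<^sup>2 * (u\<^sup>2 + 14 * u * k + 81 * k\<^sup>2)"
    by (simp add: power2_eq_square power3_eq_cube power4_eq_xxxx algebra_simps)
  moreover have "0 \<le> (u - k)\<^sup>2 * (u\<^sup>2 + 14 * u * k + 81 * k\<^sup>2)" using assms by simp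
  ultimately show ?thesis by linarith
qed

text \<open>The choice of \<open>a\<^sub>t\<close> makes the decrease of the sufficient decrease condition pay for the term
  that is linear in the step.\<close>

lemma step_size_young:
  fixes a B M s \<gamma> :: real
  assumes a: "a > 0" "a ^ 4 = 4\<^sup>2 * B ^ 3 / (18 ^ 3 * M)" and M: "M > 0" and B: "B > 0"
    and s: "s \<ge> 0" and \<gamma>: "\<gamma> \<ge> 0"
  shows "a * \<gamma> * s \<le> s ^ 4 / 12 + B * (1 / (6 * M powr (1/3)) * \<gamma> powr (4/3))"
proof -
  define w m where "w = \<gamma> powr (1/3)" and "m = M powr (1/3)"
  have w: "\<gamma> = w ^ 3" "\<gamma> powr (4/3) = w ^ 4" and m: "M = m ^ 3" "m > 0"
    using powr_third[OF \<gamma>] powr_third[of M] M by (simp_all add: w_def m_def)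
  \<comment> \<open>\<open>k\<close> is one third of the gain term, so
    \<open>am_gm_one_three\<close> applies to \<open>s ^ 4 / 12\<close> and \<open>k\<close>; the
    \<open>18 ^ 3\<close> of the step size equation matches \<open>k ^ 3\<close>.\<close>
  define k where "k = B * w ^ 4 / (18 * m)"
  have k: "k \<ge> 0" using B m by (simp add: k_def)
  have "(a * \<gamma> * s) ^ 4 = (16 / 5832) * (B ^ 3 * w ^ 12 * s ^ 4 / m ^ 3)"
    by (simp add: power_mult_distrib a(2) w(1) m(1) flip: power_mult)
  also have "\<dots> \<le> (64 / 17496) * (B ^ 3 * w ^ 12 * s ^ 4 / m ^ 3)"
    using B m by (intro mult_right_mono) auto
  also have "\<dots> = 256 * (s ^ 4 / 12) * k ^ 3"
    by (simp add: k_def power_divide power_mult_distrib flip: power_mult)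
  also have "\<dots> \<le> (s ^ 4 / 12 + 3 * k) ^ 4"
    using k s by (intro am_gm_one_three) auto
  finally have "(a * \<gamma> * s) ^ 4 \<le> (s ^ 4 / 12 + 3 * k) ^ 4" .
  then have "a * \<gamma> * s \<le> s ^ 4 / 12 + 3 * k"
    by (rule power_le_imp_le_base[of _ 3, simplified]) (use k s in simp)
  also have "3 * k = B * (1 / (6 * M powr (1/3)) * \<gamma> powr (4/3))"
    by (simp add: k_def w(2) m_def)
  finally show ?thesis .
qed

text \<open>The fourth root of \<open>A\<close> grows by at least \<open>c\<close>: with
  \<open>b\<close> the new root, \<open>4 * c * b ^ 3 \<le> a \<le> b ^ 4 - \<alpha> ^ 4 \<le> 4 * b
  ^ 3 * (b - \<alpha>)\<close>.\<close>

lemma step_size_growth: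
  fixes a A c M \<alpha> :: real
  assumes a: "a > 0" "a ^ 4 = 4\<^sup>2 * (A + a) ^ 3 / (18 ^ 3 * M)" and M: "M > 0"
    and c: "c \<ge> 0" "(4 * c) ^ 4 \<le> 4\<^sup>2 / (18 ^ 3 * M)" and \<alpha>: "\<alpha> \<ge> 0" "\<alpha> ^ 4 \<le> A"
  shows "(\<alpha> + c) ^ 4 \<le> A + a"
proof -
  have A: "A \<ge> 0" using \<alpha> by (metis order_trans zero_le_power)
  define b where "b = root 4 (A + a)"
  have b: "b ^ 4 = A + a" "b > 0" using A a by (simp_all add: b_def)
  have "(4 * c * b ^ 3) ^ 4 = (4 * c) ^ 4 * (A + a) ^ 3"
    unfolding b(1)[symmetric] by (simp add: power_mult_distrib flip: power_mult)
  also have "\<dots> \<le> a ^ 4" unfolding a(2)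
    using mult_right_mono[OF c(2), of "(A + a) ^ 3"] A a by simp
  finally have "4 * c * b ^ 3 \<le> a"
    by (rule power_le_imp_le_base[of _ 3, simplified]) (use a in simp)
  then have 1: "4 * c * b ^ 3 \<le> b ^ 4 - \<alpha> ^ 4" using b(1) \<alpha>(2) by simp
  have "\<alpha> ^ 4 \<le> b ^ 4" using b(1) \<alpha>(2) a by simp
  then have \<alpha>b: "\<alpha> \<le> b" using b(2) by (simp add: power_mono_iff[OF \<alpha>(1)])
  have "b ^ 4 - \<alpha> ^ 4 = (b - \<alpha>) * (b ^ 3 + b ^ 2 * \<alpha> + b * \<alpha> ^ 2 + \<alpha> ^ 3)"
    by (simp add: power2_eq_square power3_eq_cube power4_eq_xxxx algebra_simps)
  also have "\<dots> \<le> (b - \<alpha>) * (b ^ 3 + b ^ 2 * b + b * b ^ 2 + b ^ 3)"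
    using \<alpha> \<alpha>b b(2) by (intro mult_left_mono add_mono power_mono) auto
  also have "\<dots> = 4 * b ^ 3 * (b - \<alpha>)" by (simp add: power2_eq_square power3_eq_cube algebra_simps)
  finally have "4 * b ^ 3 * c \<le> 4 * b ^ 3 * (b - \<alpha>)" using 1 by (simp add: mult_ac)
  then have "\<alpha> + c \<le> b" using b(2) by (simp add: mult_le_cancel_left)
  then have "(\<alpha> + c) ^ 4 \<le> b ^ 4" using \<alpha> c by (intro power_mono) auto
  then show ?thesis by (simp add: b(1))
qed

text \<open>Taylor bound for \<open>D2 f\<close> at distance \<open>3 * R0\<close> from
  \<open>x0\<close>, which covers the ball of radius \<open>2 * R0\<close> about the
  minimizer.\<close>

definition hess_const :: "real \<Rightarrow> real \<Rightarrow> real \<Rightarrow> real \<Rightarrow> real" where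
  "hess_const L R0 \<eta> \<kappa> = \<eta> + 3 * \<kappa> * R0 + 9 * L * R0\<^sup>2"

locale accelerated = composite_model f L \<psi>
  for f :: "real^'n \<Rightarrow> real" and L :: real and \<psi> :: "real^'n \<Rightarrow> ereal" +
  fixes xstar x0 :: "real^'n" and M0 R0 L\<^sub>\<psi> \<eta> \<kappa> :: real
  assumes xstar: "is_arg_min (composite f \<psi>) (\<lambda>_. True) xstar"
    and x0_edom: "x0 \<in> edom \<psi>"
    and level: "\<And>x. composite f \<psi> x \<le> composite f \<psi> x0 \<Longrightarrow> norm (x - xstar) \<le> R0"
    and subdiff_bound: "\<And>z g. g \<in> subdiff \<psi> z \<Longrightarrow> norm g \<le> L\<^sub>\<psi>"
    and eta: "onorm ((*v) (hessian f x0)) = \<eta>" and kappa: "norm (D3 f x0) = \<kappa>"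
    and M0_pos: "M0 > 0"
begin

abbreviation F :: "real^'n \<Rightarrow> real" where "F x \<equiv> f x + p x"

lemma composite_eq: "x \<in> edom \<psi> \<Longrightarrow> composite f \<psi> x = ereal (F x)"
  by (simp add: composite_def psi_eq)

lemma xstar_edom: "xstar \<in> edom \<psi>"
proof (rule ccontr)
  assume "xstar \<notin> edom \<psi>"
  then have "composite f \<psi> x0 < composite f \<psi> xstar"
    by (simp add: composite_def psi_outside psi_eq[OF x0_edom])
  then show False using xstar by (simp add: is_arg_min_def)
qed

section \<open>Bounds on the data near the minimizer\<close>

lemma F_xstar_le: "y \<in> edom \<psi> \<Longrightarrow> F xstar \<le> F y"
  using xstar composite_eq[of y] composite_eq[OF xstar_edom]
  unfolding is_arg_min_def by (metis ereal_less_eq(3) not_less)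

lemma level_F: "x \<in> edom \<psi> \<Longrightarrow> F x \<le> F x0 \<Longrightarrow> norm (x - xstar) \<le> R0"
  by (rule level) (simp add: composite_eq x0_edom)

lemma x0_xstar: "norm (x0 - xstar) \<le> R0"
  by (rule level_F[OF x0_edom]) simp

lemma R0_nonneg: "R0 \<ge> 0"
  using x0_xstar norm_ge_zero order_trans by blast

lemma approx_minimizer_iff:
  "x \<in> edom \<psi> \<Longrightarrow> approx_minimizer f \<psi> xstar \<epsilon> x G \<longleftrightarrow> norm G \<le> \<epsilon> \<or> F x - F xstar \<le> \<epsilon>"
  by (simp add: approx_minimizer_def composite_eq xstar_edom min_le_iff_disj)

text \<open>The data contain no gradient of \<open>f\<close>; optimality supplies one, as it bounds
  \<open>grad f xstar\<close> by \<open>L\<^sub>\<psi>\<close>.\<close>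

lemma grad_xstar: "- grad f xstar \<in> subdiff \<psi> xstar"
proof -
  have "p xstar - D1 f xstar (u - xstar) \<le> p u" if "u \<in> edom \<psi>" for u
    using composite_minimizer_variational[OF p_convex fderiv_has_derivative[OF diff1] xstar_edom that F_xstar_le]
    by simp
  then show ?thesis by (simp add: subdiff_iff xstar_edom grad_f)
qed

lemma kappa_nonneg: "\<kappa> \<ge> 0" using kappa norm_ge_zero by metis

lemma D2_bound:
  assumes "norm (y - xstar) \<le> 2 * R0"
  shows "norm (D2 f y) \<le> hess_const L R0 \<eta> \<kappa>"
proof -
  have bl: "bounded_linear ((*v) (hessian f x0))" by (rule matrix_vector_mul_bounded_linear)
  have \<eta>: "norm (D2 f x0) \<le> \<eta>"
  proof (rule norm_blinfun_bound)
    show "\<eta> \<ge> 0" using onorm_pos_le[OF bl] eta by simp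
    show "norm (D2 f x0 w) \<le> \<eta> * norm w" for w
    proof (rule norm_blinfun_bound)
      show "0 \<le> \<eta> * norm w" using \<open>\<eta> \<ge> 0\<close> by simp
      show "norm (D2 f x0 w v) \<le> \<eta> * norm w * norm v" for v
      proof -
        have "norm (D2 f x0 w v) \<le> norm (hessian f x0 *v w) * norm v"
          unfolding hessian_inner[symmetric] using Cauchy_Schwarz_ineq2 by simp
        also have "\<dots> \<le> \<eta> * norm w * norm v"
          using onorm[OF bl, of w] eta by (intro mult_right_mono) auto
        finally show ?thesis .
      qed
    qed
  qed
  define m where "m = y - x0"
  have m: "norm m \<le> 3 * R0"
    using assms x0_xstar norm_triangle_ineq4[of "y - xstar" "x0 - xstar"] unfolding m_def by simp
  have "norm (D2 f y) \<le> norm (D2 f (x0 + m) - D2 f x0 - D3 f x0 m) + (norm (D2 f x0) + norm (D3 f x0 m))"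
    using norm_triangle_ineq[of "D2 f (x0 + m) - D2 f x0 - D3 f x0 m" "D2 f x0 + D3 f x0 m"]
      norm_triangle_ineq[of "D2 f x0" "D3 f x0 m"] by (simp add: m_def)
  also have "\<dots> \<le> L * (3 * R0) ^ 2 + (\<eta> + \<kappa> * (3 * R0))"
  proof (intro add_mono)
    show "norm (D2 f (x0 + m) - D2 f x0 - D3 f x0 m) \<le> L * (3 * R0) ^ 2"
      using D2_remainder[of x0 m] mult_left_mono[OF power_mono[OF m norm_ge_zero] L_nonneg, of 2] by linarith
    show "norm (D3 f x0 m) \<le> \<kappa> * (3 * R0)"
      using norm_blinfun[of "D3 f x0" m] mult_left_mono[OF m kappa_nonneg] by (simp add: kappa)
  qed (rule \<eta>)
  finally show ?thesis by (simp add: hess_const_def power_mult_distrib algebra_simps)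
qed

lemma hess_const_nonneg: "hess_const L R0 \<eta> \<kappa> \<ge> 0"
  by (rule order_trans[OF norm_ge_zero D2_bound[of xstar]]) (simp add: R0_nonneg)

lemma trace_bound:
  assumes "norm (y - xstar) \<le> 2 * R0"
  shows "trace (hessian f y) \<le> CARD('n) * hess_const L R0 \<eta> \<kappa>"
proof -
  have "D2 f y (axis i 1) (axis i 1) \<le> hess_const L R0 \<eta> \<kappa>" for i :: 'n
  proof -
    have "D2 f y (axis i 1) (axis i 1) \<le> norm (D2 f y (axis i 1)) * norm (axis i (1::real))"
      using norm_blinfun[of "D2 f y (axis i 1)" "axis i 1"] by simp
    also have "\<dots> \<le> norm (D2 f y)" using norm_blinfun[of "D2 f y" "axis i 1"] by simp
    finally show ?thesis using D2_bound[OF assms] by simp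
  qed
  then show ?thesis unfolding trace_hessian
    using sum_bounded_above[of UNIV "\<lambda>i. D2 f y (axis i 1) (axis i 1)" "hess_const L R0 \<eta> \<kappa>"] by simp
qed

lemma subgradient_bound:
  assumes y: "norm (y - xstar) \<le> 2 * R0" and G: "G \<in> subdiff_composite f \<psi> y"
  shows "norm G \<le> 2 * L\<^sub>\<psi> + 2 * R0 * hess_const L R0 \<eta> \<kappa>"
proof -
  let ?H = "hess_const L R0 \<eta> \<kappa>"
  have gs: "norm (grad f xstar) \<le> L\<^sub>\<psi>" using subdiff_bound[OF grad_xstar] by simp
  have "norm (D1 f y - D1 f xstar) \<le> ?H * norm (y - xstar)"
  proof (rule differentiable_bound[where S = "cball xstar (2 * R0)" and f' = "\<lambda>z. blinfun_apply (D2 f z)"])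
    show "(D1 f has_derivative blinfun_apply (D2 f z)) (at z within cball xstar (2 * R0))" for z
      using fderiv_has_derivative[OF diff2] has_derivative_at_withinI by blast
    show "onorm (blinfun_apply (D2 f z)) \<le> ?H" if "z \<in> cball xstar (2 * R0)" for z
      using D2_bound[of z] that by (simp add: norm_blinfun.rep_eq dist_norm norm_minus_commute)
  qed (use y R0_nonneg in \<open>auto simp: dist_norm norm_minus_commute\<close>)
  also have "\<dots> \<le> ?H * (2 * R0)" using y hess_const_nonneg by (intro mult_left_mono) auto
  finally have d: "norm (D1 f y - D1 f xstar) \<le> ?H * (2 * R0)" .
  have "norm (grad f y - grad f xstar) \<le> ?H * (2 * R0)"
  proof (rule norm_le_of_inner)
    fix w
    have "\<bar>(grad f y - grad f xstar) \<bullet> w\<bar> = norm ((D1 f y - D1 f xstar) w)"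
      by (simp add: inner_diff_left grad_f blinfun.diff_left)
    also have "\<dots> \<le> norm (D1 f y - D1 f xstar) * norm w" by (rule norm_blinfun)
    also have "\<dots> \<le> ?H * (2 * R0) * norm w" using d by (rule mult_right_mono) simp
    finally show "\<bar>(grad f y - grad f xstar) \<bullet> w\<bar> \<le> ?H * (2 * R0) * norm w" .
  qed (use hess_const_nonneg R0_nonneg in simp)
  moreover obtain g where g: "g \<in> subdiff \<psi> y" "G = grad f y + g" using G by (auto simp: subdiff_composite_def)
  moreover have "norm g \<le> L\<^sub>\<psi>" by (rule subdiff_bound[OF g(1)])
  moreover have "norm G \<le> norm (grad f y - grad f xstar) + norm (grad f xstar) + norm g"
    using norm_triangle_ineq[of "(grad f y - grad f xstar) + grad f xstar" g]
      norm_triangle_ineq[of "grad f y - grad f xstar" "grad f xstar"] by (simp add: g(2))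
  ultimately show ?thesis using gs by (simp add: mult_ac)
qed

text \<open>Real-valued form of the estimating function; \<open>c + g \<bullet> y\<close> collects
  the weighted linearizations of all accepted steps.\<close>

definition estimate :: "(real^'n) outer \<Rightarrow> real \<Rightarrow> real^'n \<Rightarrow> real^'n \<Rightarrow> real" where
  "estimate S c g y = norm (y - x0) ^ 4 / 4 + (c + g \<bullet> y) + st_A S * p y"

text \<open>The clause for \<open>st_A S = 0\<close> handles the start, where the inequality for
  \<open>st_A S * F (st_x S)\<close> says nothing about \<open>st_x S\<close>.\<close>

definition outer_invariant :: "(real^'n) outer \<Rightarrow> bool" where
  "outer_invariant S \<longleftrightarrow> st_A S \<ge> 0 \<and> (st_A S = 0 \<longrightarrow> st_x S = x0) \<and> st_x S \<in> edom \<psi> \<and> st_v S \<in> edom \<psi> \<and>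
     (\<exists>c g. (\<forall>y. c + g \<bullet> y \<le> st_A S * f y) \<and> (\<forall>y\<in>edom \<psi>. st_phi S y = ereal (estimate S c g y)) \<and>
        (\<forall>y\<in>edom \<psi>. estimate S c g (st_v S) \<le> estimate S c g y) \<and>
        st_A S * F (st_x S) \<le> estimate S c g (st_v S))"

text \<open>All growth comes from the quartic term, a third of a quarter; the rest enters through
  first-order optimality at \<open>v\<close>.\<close>

lemma estimate_uniformly_convex:
  assumes A: "st_A S \<ge> 0" and v: "v \<in> edom \<psi>" and y: "y \<in> edom \<psi>"
    and min: "\<And>y. y \<in> edom \<psi> \<Longrightarrow> estimate S c g v \<le> estimate S c g y"
  shows "estimate S c g v + norm (y - v) ^ 4 / 12 \<le> estimate S c g y"
proof -
  define q where "q = (\<lambda>y. norm (y - x0) ^ 4 / 4 + (c + g \<bullet> y))"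
  have cvx: "convex_on (edom \<psi>) (\<lambda>y. st_A S * p y)" using p_convex A by (rule convex_on_cmul[rotated])
  have "((\<lambda>y. 1/4 * norm (y - x0) ^ 4 + (c + g \<bullet> y)) has_derivative
      (\<lambda>w. 1/4 * (4 * norm (v - x0) ^ 2 * ((v - x0) \<bullet> w)) + g \<bullet> w)) (at v)"
    by (intro has_derivative_add has_derivative_mult_right norm_pow4_has_derivative)
      (auto intro!: derivative_eq_intros)
  then have der: "(q has_derivative (\<lambda>w. norm (v - x0) ^ 2 * ((v - x0) \<bullet> w) + g \<bullet> w)) (at v)"
    unfolding q_def by simp
  have "q v + st_A S * p v \<le> q w + st_A S * p w" if "w \<in> edom \<psi>" for w
    using min[OF that] unfolding estimate_def q_def .
  from composite_minimizer_variational[OF cvx der v y this]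
  have "st_A S * p v \<le> st_A S * p y + (norm (v - x0) ^ 2 * ((v - x0) \<bullet> (y - v)) + g \<bullet> (y - v))" .
  moreover have "norm (y - v) ^ 4 \<le> 3 * (norm (y - x0) ^ 4 - norm (v - x0) ^ 4 - 4 * norm (v - x0) ^ 2 * ((v - x0) \<bullet> (y - v)))"
    using norm_pow4_uniformly_convex[of "y - v" "v - x0"] by simp
  moreover have "g \<bullet> (y - v) = g \<bullet> y - g \<bullet> v" by (rule inner_diff_right)
  ultimately show ?thesis unfolding estimate_def by (simp add: algebra_simps)
qed

text \<open>The affine minorant puts the estimate below
  \<open>norm (y - x0) ^ 4 / 4 + st_A S * F y\<close>. Evaluation at \<open>xstar\<close> gives the
  first two bounds, evaluation at \<open>x0\<close> gives level set membership.\<close>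

lemma outer_bounds:
  assumes inv: "outer_invariant S"
  shows "st_A S * (F (st_x S) - F xstar) \<le> R0 ^ 4 / 4"
    and "norm (st_v S - xstar) \<le> 2 * R0" and "norm (st_x S - xstar) \<le> R0"
proof -
  from inv obtain c g where A: "st_A S \<ge> 0" "st_A S = 0 \<Longrightarrow> st_x S = x0" and xv: "st_x S \<in> edom \<psi>" "st_v S \<in> edom \<psi>"
    and lin: "\<And>y. c + g \<bullet> y \<le> st_A S * f y"
    and min: "\<And>y. y \<in> edom \<psi> \<Longrightarrow> estimate S c g (st_v S) \<le> estimate S c g y"
    and low: "st_A S * F (st_x S) \<le> estimate S c g (st_v S)"
    unfolding outer_invariant_def by blast
  have up: "estimate S c g y \<le> norm (y - x0) ^ 4 / 4 + st_A S * F y" for y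
    using lin[of y] unfolding estimate_def by (simp add: distrib_left)
  have 1: "st_A S * F (st_x S) + norm (xstar - st_v S) ^ 4 / 12 \<le> norm (xstar - x0) ^ 4 / 4 + st_A S * F xstar"
    using low up[of xstar] estimate_uniformly_convex[OF A(1) xv(2) xstar_edom min] by linarith
  have r: "norm (xstar - x0) ^ 4 \<le> R0 ^ 4"
    using x0_xstar by (intro power_mono) (auto simp: norm_minus_commute)
  have "0 \<le> norm (xstar - st_v S) ^ 4" by simp
  then show "st_A S * (F (st_x S) - F xstar) \<le> R0 ^ 4 / 4"
    using 1 r unfolding right_diff_distrib by linarith
  have "st_A S * F xstar \<le> st_A S * F (st_x S)" using F_xstar_le[OF xv(1)] A by (intro mult_left_mono)
  then have "norm (xstar - st_v S) ^ 4 \<le> 3 * R0 ^ 4" using 1 r by linarith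
  also have "\<dots> \<le> (2 * R0) ^ 4" using R0_nonneg by (simp add: power_mult_distrib)
  finally have "norm (xstar - st_v S) \<le> 2 * R0"
    by (rule power_le_imp_le_base[of _ 3, simplified]) (use R0_nonneg in simp)
  then show "norm (st_v S - xstar) \<le> 2 * R0" by (simp add: norm_minus_commute)
  show "norm (st_x S - xstar) \<le> R0"
  proof (cases "st_A S = 0")
    case True then show ?thesis using A x0_xstar by simp
  next
    case False
    have "st_A S * F (st_x S) \<le> st_A S * F x0" using low min[OF x0_edom] up[of x0] by simp
    then have "F (st_x S) \<le> F x0" using False A by (simp add: mult_le_cancel_left)
    then show ?thesis by (rule level_F[OF xv(1)])
  qed
qed

lemma outer_initial: "outer_invariant (initial_outer x0 M)"
  unfolding outer_invariant_def
  by (auto simp: initial_outer_def estimate_def x0_edom intro!: exI[of _ 0])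

lemma trial_z_bounds:
  assumes inv: "outer_invariant S" and a: "a > 0"
  shows "trial_z S a \<in> edom \<psi>" and "norm (trial_z S a - xstar) \<le> 2 * R0"
proof -
  define u where "u = a / (st_A S + a)"
  have A: "st_A S \<ge> 0" and xv: "st_x S \<in> edom \<psi>" "st_v S \<in> edom \<psi>" using inv unfolding outer_invariant_def by auto
  have u: "0 \<le> u" "u \<le> 1" using A a by (auto simp: u_def)
  have z: "trial_z S a = (1 - u) *\<^sub>R st_x S + u *\<^sub>R st_v S" by (simp add: trial_z_def u_def Let_def)
  show "trial_z S a \<in> edom \<psi>" unfolding z using edom_convex_combination[OF xv u] by blast
  have "trial_z S a - xstar = (1 - u) *\<^sub>R (st_x S - xstar) + u *\<^sub>R (st_v S - xstar)"
    unfolding z by (simp add: algebra_simps)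
  also have "norm \<dots> \<le> (1 - u) * norm (st_x S - xstar) + u * norm (st_v S - xstar)"
    using norm_triangle_ineq[of "(1 - u) *\<^sub>R (st_x S - xstar)" "u *\<^sub>R (st_v S - xstar)"] u by simp
  also have "\<dots> \<le> (1 - u) * (2 * R0) + u * (2 * R0)"
    using outer_bounds[OF inv] R0_nonneg u by (intro add_mono mult_left_mono) auto
  finally show "norm (trial_z S a - xstar) \<le> 2 * R0" by (simp add: algebra_simps)
qed

lemma outer_step:
  assumes inv: "outer_invariant S" and a: "trial_a S i a" and M: "trial_M S i > 0"
    and g': "g' \<in> subdiff \<psi> y'" and Gp: "Gp = grad f y' + g'"
    and dec: "sufficient_decrease (trial_M S i) (trial_z S a) y' Gp"
    and upd: "outer_update f \<psi> S i a y' S'"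
  shows "outer_invariant S'"
proof -
  from inv obtain c g where A: "st_A S \<ge> 0" and xv: "st_x S \<in> edom \<psi>" "st_v S \<in> edom \<psi>"
    and lin: "\<And>y. c + g \<bullet> y \<le> st_A S * f y"
    and phi: "\<And>y. y \<in> edom \<psi> \<Longrightarrow> st_phi S y = ereal (estimate S c g y)"
    and min: "\<And>y. y \<in> edom \<psi> \<Longrightarrow> estimate S c g (st_v S) \<le> estimate S c g y"
    and low: "st_A S * F (st_x S) \<le> estimate S c g (st_v S)"
    unfolding outer_invariant_def by blast
  from upd obtain v' where v': "is_arg_min (next_phi f \<psi> S a y') (\<lambda>x. x \<in> edom \<psi>) v'"
    and S': "S' = \<lparr>st_x = y', st_v = v', st_A = st_A S + a, st_M = trial_M S i / 2, st_phi = next_phi f \<psi> S a y'\<rparr>"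
    unfolding outer_update_def by blast
  have a0: "a > 0" and a4: "a ^ 4 = 4\<^sup>2 * (st_A S + a) ^ 3 / (18 ^ 3 * trial_M S i)"
    using a by (auto simp: trial_a_def)
  have y': "y' \<in> edom \<psi>" and sub: "\<And>y. y \<in> edom \<psi> \<Longrightarrow> p y' + g' \<bullet> (y - y') \<le> p y"
    using g' by (auto simp: subdiff_iff)
  define B where "B = st_A S + a"
  have B: "B > 0" using A a0 by (simp add: B_def)
  define c' where "c' = c + a * (f y' - grad f y' \<bullet> y')"
  define h' where "h' = g + a *\<^sub>R grad f y'"
  have est: "estimate S' c' h' y = estimate S c g y + a * (f y' + grad f y' \<bullet> (y - y') + p y)" for y
    unfolding estimate_def S' c'_def h'_def by (simp add: inner_add_left inner_diff_right algebra_simps)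
  have phi': "next_phi f \<psi> S a y' y = ereal (estimate S' c' h' y)" if "y \<in> edom \<psi>" for y
    using that unfolding next_phi_def est by (simp add: phi psi_eq)
  have v'dom: "v' \<in> edom \<psi>" using v' by (simp add: is_arg_min_def)
  have min': "estimate S' c' h' v' \<le> estimate S' c' h' y" if "y \<in> edom \<psi>" for y
  proof -
    have "\<not> next_phi f \<psi> S a y' y < next_phi f \<psi> S a y' v'" using v' that unfolding is_arg_min_def by blast
    then show ?thesis by (simp add: phi'[OF that] phi'[OF v'dom])
  qed
  have lin': "c' + h' \<bullet> y \<le> B * f y" for y
  proof -
    have "f y' + grad f y' \<bullet> (y - y') \<le> f y" using tangent_le[of y' y] by (simp add: grad_f)
    then have "a * (f y' + grad f y' \<bullet> (y - y')) \<le> a * f y" using a0 by (intro mult_left_mono) auto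
    moreover have "c' + h' \<bullet> y = c + g \<bullet> y + a * (f y' + grad f y' \<bullet> (y - y'))"
      unfolding c'_def h'_def by (simp add: inner_add_left inner_diff_right algebra_simps)
    ultimately show ?thesis using lin[of y] unfolding B_def distrib_right by linarith
  qed
  \<comment> \<open>Proved at every point of the domain, hence at the new minimizer. The
    inequalities at \<open>y'\<close> are combined with weights \<open>st_A S\<close> and
    \<open>a\<close>.\<close>
  have low': "B * F y' \<le> estimate S' c' h' y" if y: "y \<in> edom \<psi>" for y
  proof -
    define s where "s = norm (y - st_v S)"
    have 1: "st_A S * F (st_x S) + s ^ 4 / 12 \<le> estimate S c g y"
      using low estimate_uniformly_convex[OF A xv(2) y min] unfolding s_def by linarith
    have "F y' + Gp \<bullet> (st_x S - y') \<le> F (st_x S)"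
      using tangent_le[of y' "st_x S"] sub[OF xv(1)] by (simp add: Gp inner_add_left grad_f)
    then have 2: "st_A S * (F y' + Gp \<bullet> (st_x S - y')) \<le> st_A S * F (st_x S)" using A by (rule mult_left_mono)
    have "F y' + Gp \<bullet> (y - y') \<le> f y' + grad f y' \<bullet> (y - y') + p y"
      using sub[OF y] by (simp add: Gp inner_add_left)
    then have 3: "a * (F y' + Gp \<bullet> (y - y')) \<le> a * (f y' + grad f y' \<bullet> (y - y') + p y)"
      using a0 by (intro mult_left_mono) auto
    \<comment> \<open>The definition of \<open>trial_z\<close> regroups the linear terms: sufficient
      decrease handles the part at the trial center, uniform convexity and
      \<open>step_size_young\<close> the part in \<open>y - st_v S\<close>.\<close>
    have "B *\<^sub>R trial_z S a = st_A S *\<^sub>R st_x S + a *\<^sub>R st_v S"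
    proof -
      have "B * (1 - a / B) = st_A S" "B * (a / B) = a" using B by (simp_all add: B_def field_simps)
      then show ?thesis unfolding trial_z_def Let_def B_def[symmetric] by (simp add: scaleR_add_right)
    qed
    then have "st_A S *\<^sub>R (st_x S - y') + a *\<^sub>R (y - y') = B *\<^sub>R (trial_z S a - y') + a *\<^sub>R (y - st_v S)"
      by (simp add: B_def algebra_simps)
    from arg_cong[OF this, of "(\<bullet>) Gp"]
    have "st_A S * (Gp \<bullet> (st_x S - y')) + a * (Gp \<bullet> (y - y')) = B * (Gp \<bullet> (trial_z S a - y')) + a * (Gp \<bullet> (y - st_v S))"
      unfolding inner_add_right inner_scaleR_right .
    moreover have "B * (1 / (6 * trial_M S i powr (1/3)) * norm Gp powr (4/3)) \<le> B * (Gp \<bullet> (trial_z S a - y'))"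
      using dec B unfolding sufficient_decrease_def by (intro mult_left_mono) auto
    moreover have "- (a * norm Gp * s) \<le> a * (Gp \<bullet> (y - st_v S))"
    proof -
      have "- (norm Gp * s) \<le> Gp \<bullet> (y - st_v S)"
        using Cauchy_Schwarz_ineq2[of Gp "y - st_v S"] unfolding s_def by linarith
      then have "a * (- (norm Gp * s)) \<le> a * (Gp \<bullet> (y - st_v S))" using a0 by (intro mult_left_mono) auto
      then show ?thesis by simp
    qed
    moreover have "a * norm Gp * s \<le> s ^ 4 / 12 + B * (1 / (6 * trial_M S i powr (1/3)) * norm Gp powr (4/3))"
      by (rule step_size_young) (use a0 a4 M B in \<open>auto simp: B_def s_def\<close>)
    ultimately have "0 \<le> s ^ 4 / 12 + (st_A S * (Gp \<bullet> (st_x S - y')) + a * (Gp \<bullet> (y - y')))" by linarith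
    moreover have "st_A S * (F y' + Gp \<bullet> (st_x S - y')) + a * (F y' + Gp \<bullet> (y - y')) =
        B * F y' + (st_A S * (Gp \<bullet> (st_x S - y')) + a * (Gp \<bullet> (y - y')))"
      by (simp add: B_def algebra_simps)
    ultimately show ?thesis using 1 2 3 unfolding est by linarith
  qed
  show ?thesis
    unfolding outer_invariant_def
  proof (intro conjI exI[of _ c'] exI[of _ h'] allI ballI impI)
    show "c' + h' \<bullet> y \<le> st_A S' * f y" for y using lin' by (simp add: S' B_def)
    show "st_phi S' y = ereal (estimate S' c' h' y)" if "y \<in> edom \<psi>" for y
      using phi'[OF that] by (simp add: S')
    show "estimate S' c' h' (st_v S') \<le> estimate S' c' h' y" if "y \<in> edom \<psi>" for y
      using min'[OF that] by (simp add: S')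
    show "st_A S' * F (st_x S') \<le> estimate S' c' h' (st_v S')"
      using low'[OF v'dom] by (simp add: S' B_def)
  qed (use B y' v'dom in \<open>auto simp: S' B_def\<close>)
qed

end

section \<open>Counting the iterations\<close>

text \<open>Failure and insufficient decrease are merged into \<open>retry\<close>, since both
  restart with \<open>M\<close> doubled.\<close>

lemma step_Solving_cases:
  assumes "step f \<psi> M0 \<epsilon> (Solving S i a G k y) lab c'"
  obtains (continue) y' where "inner_iterate f \<psi> (trial_z S a) (trial_M S i) y y'"
      "inner_verdict f \<epsilon> (trial_z S a) G (trial_M S i) k y y' = Continue"
      "c' = Solving S i a G (Suc k) y'"
  | (halt) y' Gp where "inner_iterate f \<psi> (trial_z S a) (trial_M S i) y y'" "lab = Some (y', Gp)" "norm Gp \<le> \<epsilon>"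
  | (retry) y' Gp where "inner_iterate f \<psi> (trial_z S a) (trial_M S i) y y'"
      "Gp = grad f y' + g_psi f (trial_z S a) (trial_M S i) y y'"
      "inner_verdict f \<epsilon> (trial_z S a) G (trial_M S i) k y y' = Failure \<or>
       inner_verdict f \<epsilon> (trial_z S a) G (trial_M S i) k y y' = Success \<and> norm Gp > \<epsilon> \<and>
         \<not> sufficient_decrease (trial_M S i) (trial_z S a) y' Gp"
      "begin_trial f \<psi> S (Suc i) c'"
  | (accept) y' Gp S' where "inner_iterate f \<psi> (trial_z S a) (trial_M S i) y y'"
      "Gp = grad f y' + g_psi f (trial_z S a) (trial_M S i) y y'" "lab = Some (y', Gp)"
      "sufficient_decrease (trial_M S i) (trial_z S a) y' Gp"
      "outer_update f \<psi> S i a y' S'" "begin_trial f \<psi> S' (first_i M0 S') c'"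
  using assms by (cases rule: step.cases) (blast+)

text \<open>The first index is 1 if \<open>l = 0\<close> and 0 otherwise.\<close>

lemma trial_M_first_i:
  assumes "st_M S = 2 ^ l * M0" and "M0 > 0"
  shows "trial_M S (first_i M0 S) = 2 ^ max 1 l * M0"
proof (cases l)
  case 0
  have "first_i M0 S = 1" unfolding first_i_def
  proof (rule Least_equality)
    show "1 \<le> i" if "2 * M0 \<le> 2 ^ i * st_M S" for i
      using that assms 0 by (cases i) auto
  qed (use assms 0 in simp)
  then show ?thesis using assms 0 by (simp add: trial_M_def)
next
  case (Suc l')
  have "M0 * 1 \<le> M0 * 2 ^ l'" using assms(2) by (intro mult_left_mono) auto
  then have "first_i M0 S = 0" unfolding first_i_def
    using assms Suc by (intro Least_equality) auto
  then show ?thesis using assms Suc by (simp add: trial_M_def max_def)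
qed

text \<open>\<open>2 * M0\<close> is the first trial value; a retry occurs only below
  \<open>16 * L\<close> and doubles \<open>M\<close>.\<close>

definition max_trial_M :: "real \<Rightarrow> real \<Rightarrow> real" where
  "max_trial_M L M0 = max (2 * M0) (32 * L)"

text \<open>Guaranteed increase of the fourth root of \<open>A\<close> per accepted step, at the
  largest trial \<open>M\<close>.\<close>

definition growth_const :: "real \<Rightarrow> real \<Rightarrow> real" where
  "growth_const L M0 = root 4 (4\<^sup>2 / (18 ^ 3 * max_trial_M L M0)) / 4"

text \<open>Worst case of the failure threshold without its geometric factor: \<open>T\<close>
  bounds the trace, \<open>g\<close> bounds \<open>96 * norm G / M\<close>, and
  \<open>4 * M0\<close> is twice the smallest trial value.\<close>

definition inner_const :: "nat \<Rightarrow> real \<Rightarrow> real \<Rightarrow> real \<Rightarrow> real \<Rightarrow> real \<Rightarrow> real \<Rightarrow> real" where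
  "inner_const n L M0 R0 L\<^sub>\<psi> \<eta> \<kappa> =
     (let H = hess_const L R0 \<eta> \<kappa>; T = real n * H; M = max_trial_M L M0;
          g = 96 * (2 * L\<^sub>\<psi> + 2 * R0 * H) / (2 * M0)
      in 3 ^ 8 * (T + 3 * M / 2 * g powr (2/3)) ^ 4 * (1/2 * T * g powr (2/3) + M / 8 * g powr (4/3)) / (4 * M0))"

text \<open>Coefficient of \<open>\<bar>log (6/5) \<epsilon>\<bar>\<close> in the iterations per
  execution: 4 comes from \<open>\<epsilon> ^ 4\<close>, 2 from the index offset in
  \<open>continue_index\<close>. The maximum keeps the logarithm nonnegative.\<close>

definition inner_iterations :: "nat \<Rightarrow> real \<Rightarrow> real \<Rightarrow> real \<Rightarrow> real \<Rightarrow> real \<Rightarrow> real \<Rightarrow> real" where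
  "inner_iterations n L M0 R0 L\<^sub>\<psi> \<eta> \<kappa> = log (6/5) (max 1 (7 ^ 4 * inner_const n L M0 R0 L\<^sub>\<psi> \<eta> \<kappa>)) + 6"

definition total_trials :: "real \<Rightarrow> real \<Rightarrow> real \<Rightarrow> real" where
  "total_trials L M0 R0 = 2 * R0 / growth_const L M0 + log 2 (max_trial_M L M0 / M0) + 1"

lemma growth_const:
  assumes "M0 > 0"
  shows "growth_const L M0 > 0" "(4 * growth_const L M0) ^ 4 = 4\<^sup>2 / (18 ^ 3 * max_trial_M L M0)"
proof -
  have "max_trial_M L M0 > 0" using assms by (simp add: max_trial_M_def)
  then show "growth_const L M0 > 0" "(4 * growth_const L M0) ^ 4 = 4\<^sup>2 / (18 ^ 3 * max_trial_M L M0)"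
    by (simp_all add: growth_const_def)
qed

lemma one_le_abs_log:
  assumes "0 < \<epsilon>" "\<epsilon> \<le> 1/2"
  shows "1 \<le> \<bar>log (6/5) \<epsilon>\<bar>" "\<bar>log (6/5) \<epsilon>\<bar> = - log (6/5) \<epsilon>"
proof -
  have "log (6/5) \<epsilon> \<le> log (6/5) (inverse (6/5))"
    using assms by (subst log_le_cancel_iff) auto
  also have "\<dots> = - 1" by (subst log_inverse) auto
  finally show "1 \<le> \<bar>log (6/5) \<epsilon>\<bar>" "\<bar>log (6/5) \<epsilon>\<bar> = - log (6/5) \<epsilon>" by auto
qed

section \<open>Length of a run\<close>

context accelerated
begin

text \<open>Continuing means that the residual exceeds \<open>\<epsilon> / 7\<close> while the
  failure test caps it geometrically. This also covers trial values below
  \<open>16 * L\<close>.\<close>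

lemma continue_bound:
  assumes z: "norm (z - xstar) \<le> 2 * R0" and G: "G \<in> subdiff_composite f \<psi> z"
    and M: "2 * M0 \<le> M" "M \<le> max_trial_M L M0" and eps: "\<epsilon> > 0"
    and cont: "inner_verdict f \<epsilon> z G M k y y' = Continue"
  shows "\<epsilon> ^ 4 * (6/5) ^ k \<le> 7 ^ 4 * inner_const CARD('n) L M0 R0 L\<^sub>\<psi> \<eta> \<kappa>"
proof -
  define H where "H = hess_const L R0 \<eta> \<kappa>"
  define T where "T = CARD('n) * H"
  define Mm where "Mm = max_trial_M L M0"
  define g where "g = 96 * (2 * L\<^sub>\<psi> + 2 * R0 * H) / (2 * M0)"
  define r where "r = residual f z M y y'"
  have M0': "M > 0" using M M0_pos by linarith
  have r: "\<epsilon> / 7 < r" "r ^ 4 \<le> 3 ^ 8 * L_const f z G M ^ 4 * beta_const f z G M / (2 * M * (6/5) ^ k)"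
    using cont unfolding inner_verdict_def Let_def r_def by (auto split: if_splits)
  have tr: "0 \<le> trace (hessian f z)" "trace (hessian f z) \<le> T"
    using trace_nonneg trace_bound[OF z] by (simp_all add: T_def H_def)
  have g: "0 \<le> 96 * norm G / M" "96 * norm G / M \<le> g"
  proof -
    show "0 \<le> 96 * norm G / M" using M0' by simp
    define X where "X = 2 * L\<^sub>\<psi> + 2 * R0 * H"
    have "norm G \<le> X" unfolding H_def X_def by (rule subgradient_bound[OF z G])
    then show "96 * norm G / M \<le> g"
      unfolding g_def X_def[symmetric] using M M0_pos norm_ge_zero[of G] by (intro frac_le) linarith+
  qed
  have g2: "(96 * norm G / M) powr (2/3) \<le> g powr (2/3)" and g4: "(96 * norm G / M) powr (4/3) \<le> g powr (4/3)"
    using g by (auto intro: powr_mono2)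
  have Lc: "0 \<le> L_const f z G M" "L_const f z G M \<le> T + 3 * Mm / 2 * g powr (2/3)"
    unfolding L_const_def using tr M0' M(2) g2 by (auto intro!: add_mono mult_mono simp: Mm_def)
  have T: "T \<ge> 0" using tr by linarith
  have Bc: "0 \<le> beta_const f z G M" "beta_const f z G M \<le> 1/2 * T * g powr (2/3) + Mm / 8 * g powr (4/3)"
    unfolding beta_const_def using tr T M0' M(2) g2 g4 by (auto intro!: add_mono mult_mono simp: Mm_def)
  have "(\<epsilon> / 7) ^ 4 \<le> r ^ 4" using r(1) eps by (intro power_mono) auto
  also have "\<dots> \<le> 3 ^ 8 * (T + 3 * Mm / 2 * g powr (2/3)) ^ 4 * (1/2 * T * g powr (2/3) + Mm / 8 * g powr (4/3)) / (2 * (2 * M0) * (6/5) ^ k)"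
    by (rule order_trans[OF r(2)])
      (use Lc Bc M M0_pos in \<open>intro frac_le mult_mono power_mono mult_nonneg_nonneg zero_le_power mult_pos_pos; simp\<close>)
  also have "\<dots> = inner_const CARD('n) L M0 R0 L\<^sub>\<psi> \<eta> \<kappa> / (6/5) ^ k"
    unfolding inner_const_def Let_def H_def[symmetric] T_def[symmetric] Mm_def[symmetric] g_def[symmetric] by simp
  finally show ?thesis by (simp add: power_divide divide_simps mult_ac)
qed

text \<open>The offset 2 arises because the next index is \<open>k + 1\<close> and the run invariant
  bounds the index plus one.\<close>

lemma continue_index:
  assumes z: "norm (z - xstar) \<le> 2 * R0" and G: "G \<in> subdiff_composite f \<psi> z"
    and M: "2 * M0 \<le> M" "M \<le> max_trial_M L M0" and eps: "0 < \<epsilon>" "\<epsilon> \<le> 1/2"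
    and cont: "inner_verdict f \<epsilon> z G M k y y' = Continue"
  shows "real k + 2 \<le> inner_iterations CARD('n) L M0 R0 L\<^sub>\<psi> \<eta> \<kappa> * \<bar>log (6/5) \<epsilon>\<bar>"
proof -
  define W where "W = max 1 (7 ^ 4 * inner_const CARD('n) L M0 R0 L\<^sub>\<psi> \<eta> \<kappa>)"
  have "\<epsilon> ^ 4 * (6/5) ^ k \<le> W" using continue_bound[OF z G M eps(1) cont] by (simp add: W_def)
  then have "log (6/5) (\<epsilon> ^ 4 * (6/5) ^ k) \<le> log (6/5) W"
    using eps by (subst log_le_cancel_iff) (auto simp: W_def)
  moreover have "log (6/5) (\<epsilon> ^ 4 * (6/5) ^ k) = 4 * log (6/5) \<epsilon> + k"
    using eps by (simp add: log_mult log_nat_power)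
  ultimately have "real k + 2 \<le> log (6/5) W + 4 * \<bar>log (6/5) \<epsilon>\<bar> + 2"
    using one_le_abs_log[OF eps] by linarith
  also have "\<dots> \<le> log (6/5) W * \<bar>log (6/5) \<epsilon>\<bar> + 4 * \<bar>log (6/5) \<epsilon>\<bar> + 2 * \<bar>log (6/5) \<epsilon>\<bar>"
  proof -
    have "log (6/5) W \<ge> 0" by (simp add: W_def)
    then have "log (6/5) W * 1 \<le> log (6/5) W * \<bar>log (6/5) \<epsilon>\<bar>"
      using one_le_abs_log(1)[OF eps] by (intro mult_left_mono)
    then show ?thesis using one_le_abs_log(1)[OF eps] by linarith
  qed
  finally show ?thesis unfolding inner_iterations_def W_def[symmetric] by (simp only: algebra_simps)
qed

text \<open>After \<open>t\<close> accepted steps with current estimate \<open>2\<^sup>m M\<^sub>0\<close>, at most \<open>2 t + m\<close> executions of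
  Algorithm 1 have ended: a retry raises \<open>m\<close> by one and an accepted step lowers it by at most one.\<close>

definition run_invariant :: "real \<Rightarrow> real \<Rightarrow> nat \<Rightarrow> (real^'n) config \<Rightarrow> bool" where
  "run_invariant \<epsilon> Q j c \<longleftrightarrow> (\<exists>S i a G k ys t m.
     c = Solving S i a G k (ys k) \<and> outer_invariant S \<and> trial_a S i a \<and>
     G \<in> subdiff_composite f \<psi> (trial_z S a) \<and> ys 0 = trial_z S a \<and>
     (\<forall>l<k. inner_iterate f \<psi> (trial_z S a) (trial_M S i) (ys l) (ys (Suc l))) \<and>
     trial_M S i = 2 ^ m * M0 \<and> 1 \<le> m \<and> trial_M S i \<le> max_trial_M L M0 \<and>
     (growth_const L M0 * real t) ^ 4 \<le> st_A S \<and> (1 \<le> t \<longrightarrow> \<epsilon> < F (st_x S) - F xstar) \<and>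
     real k + 1 \<le> Q \<and> real j \<le> Q * real (2 * t + m) + real k)"

lemma run_invariant_begin:
  assumes "begin_trial f \<psi> S i c" "outer_invariant S" "trial_M S i = 2 ^ m * M0" "1 \<le> m"
    "trial_M S i \<le> max_trial_M L M0" "(growth_const L M0 * real t) ^ 4 \<le> st_A S"
    "1 \<le> t \<Longrightarrow> \<epsilon> < F (st_x S) - F xstar" "1 \<le> Q" "real j \<le> Q * real (2 * t + m)"
  shows "run_invariant \<epsilon> Q j c"
proof -
  obtain a G where "trial_a S i a" "G \<in> subdiff_composite f \<psi> (trial_z S a)" "c = Solving S i a G 0 (trial_z S a)"
    using assms(1) unfolding begin_trial_def by blast
  then show ?thesis unfolding run_invariant_def
    using assms by (intro exI[of _ S] exI[of _ i] exI[of _ a] exI[of _ G] exI[of _ 0] exI[of _ "\<lambda>_. trial_z S a"]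
        exI[of _ t] exI[of _ m]) auto
qed

lemma run_invariant_step:
  assumes eps: "0 < \<epsilon>" "\<epsilon> \<le> 1/2"
    and Q: "Q = inner_iterations CARD('n) L M0 R0 L\<^sub>\<psi> \<eta> \<kappa> * \<bar>log (6/5) \<epsilon>\<bar>"
    and inv: "run_invariant \<epsilon> Q j c" and step: "step f \<psi> M0 \<epsilon> c lab c'"
    and no: "\<And>x G. lab = Some (x, G) \<Longrightarrow> \<not> approx_minimizer f \<psi> xstar \<epsilon> x G"
  shows "run_invariant \<epsilon> Q (Suc j) c'"
proof -
  from inv obtain S i a G k ys t m where c: "c = Solving S i a G k (ys k)" and S: "outer_invariant S"
    and a: "trial_a S i a" and G: "G \<in> subdiff_composite f \<psi> (trial_z S a)" and ys0: "ys 0 = trial_z S a"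
    and it: "\<And>l. l < k \<Longrightarrow> inner_iterate f \<psi> (trial_z S a) (trial_M S i) (ys l) (ys (Suc l))"
    and m: "trial_M S i = 2 ^ m * M0" "1 \<le> m" and Mmax: "trial_M S i \<le> max_trial_M L M0"
    and A: "(growth_const L M0 * real t) ^ 4 \<le> st_A S" and t: "1 \<le> t \<Longrightarrow> \<epsilon> < F (st_x S) - F xstar"
    and k: "real k + 1 \<le> Q" and j: "real j \<le> Q * real (2 * t + m) + real k"
    unfolding run_invariant_def by metis
  have a0: "a > 0" using a by (simp add: trial_a_def)
  note z = trial_z_bounds[OF S a0]
  have "(2::real) ^ 1 \<le> 2 ^ m" using m(2) by (intro power_increasing) auto
  then have Mmin: "2 * M0 \<le> trial_M S i" unfolding m(1) using M0_pos by (intro mult_right_mono) auto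
  then have Mpos: "trial_M S i > 0" using M0_pos by linarith
  have ne: "edom \<psi> \<noteq> {}" using x0_edom by blast
  \<comment> \<open>A finished execution took \<open>k + 1 \<le> Q\<close> iterations, charged to
    one unit of the potential \<open>2 * t + m\<close>.\<close>
  have trial_done: "real (Suc j) \<le> Q * real (2 * t + m + 1)"
    using j k by (simp add: algebra_simps)
  from step[unfolded c] show ?thesis
  proof (cases rule: step_Solving_cases)
    case (continue y')
    have "real k + 2 \<le> Q"
      unfolding Q by (rule continue_index[OF z(2) G Mmin Mmax eps continue(2)])
    then show ?thesis unfolding run_invariant_def
      using continue S a G ys0 it m Mmax A t j
      by (intro exI[of _ S] exI[of _ i] exI[of _ a] exI[of _ G] exI[of _ "Suc k"] exI[of _ "ys(Suc k := y')"]
          exI[of _ t] exI[of _ m]) (auto simp: less_Suc_eq)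
  next
    case (halt y' Gp)
    have "y' \<in> edom \<psi>" by (rule inner_iterate_edom[OF halt(1) ne])
    then show ?thesis using no[OF halt(2)] halt(3) by (simp add: approx_minimizer_iff)
  next
    case (retry y' Gp)
    have "trial_M S i < 16 * L"
    proof (rule ccontr)
      assume "\<not> trial_M S i < 16 * L"
      then have M: "16 * L \<le> trial_M S i" by simp
      \<comment> \<open>Appending the new point completes the history that \<open>no_failure\<close>
        requires.\<close>
      define ys' where "ys' = ys(Suc k := y')"
      have it': "inner_iterate f \<psi> (trial_z S a) (trial_M S i) (ys' l) (ys' (Suc l))" if "l \<le> k" for l
        using that it[of l] retry(1) by (cases "l = k") (auto simp: ys'_def)
      have "inner_verdict f \<epsilon> (trial_z S a) G (trial_M S i) k (ys' k) (ys' (Suc k)) \<noteq> Failure"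
        by (rule no_failure[where ys = ys' and k = k, OF M Mpos G _ it']) (simp_all add: ys'_def ys0)
      then have "inner_verdict f \<epsilon> (trial_z S a) G (trial_M S i) k (ys k) y' \<noteq> Failure"
        by (simp add: ys'_def)
      then show False
        using retry(3) success_decrease[OF M Mpos eps(1) _ retry(2)] by blast
    qed
    moreover have M2: "trial_M S (Suc i) = 2 * trial_M S i" by (simp add: trial_M_def)
    ultimately have M2max: "trial_M S (Suc i) \<le> max_trial_M L M0" by (simp add: max_trial_M_def)
    show ?thesis
      by (rule run_invariant_begin[where m = "Suc m", OF retry(4) S _ _ M2max A t])
        (use M2 m k trial_done in \<open>auto simp: algebra_simps\<close>)
  next
    case (accept y' Gp S')
    have y': "y' \<in> edom \<psi>" by (rule inner_iterate_edom[OF accept(1) ne])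
    have S': "outer_invariant S'"
      by (rule outer_step[OF S a Mpos inner_iterate_optimality[OF accept(1) ne] accept(2) accept(4,5)])
    have upd: "st_x S' = y'" "st_A S' = st_A S + a" "st_M S' = trial_M S i / 2"
      using accept(5) by (auto simp: outer_update_def)
    have "(2::real) * 2 ^ (m - 1) = 2 ^ m" using m(2) by (simp add: power_eq_if)
    then have "st_M S' = 2 ^ (m - 1) * M0" unfolding upd m(1) by simp
    then have M': "trial_M S' (first_i M0 S') = 2 ^ max 1 (m - 1) * M0"
      by (rule trial_M_first_i[OF _ M0_pos])
    have "(2::real) ^ max 1 (m - 1) \<le> 2 ^ m" using m(2) by (intro power_increasing) auto
    then have "2 ^ max 1 (m - 1) * M0 \<le> 2 ^ m * M0" using M0_pos by (intro mult_right_mono) auto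
    then have "trial_M S' (first_i M0 S') \<le> max_trial_M L M0"
      using Mmax unfolding M' m(1) by (rule order_trans)
    moreover have "(growth_const L M0 * real (Suc t)) ^ 4 \<le> st_A S'"
    proof -
      have "(4 * growth_const L M0) ^ 4 \<le> 4\<^sup>2 / (18 ^ 3 * trial_M S i)"
        unfolding growth_const(2)[OF M0_pos] using Mmax Mpos by (intro divide_left_mono mult_left_mono mult_pos_pos) auto
      then have "(growth_const L M0 * real t + growth_const L M0) ^ 4 \<le> st_A S + a"
        using a growth_const(1)[OF M0_pos, of L] A Mpos unfolding trial_a_def
        by (intro step_size_growth[where M = "trial_M S i"]) auto
      then show ?thesis by (simp add: upd algebra_simps)
    qed
    moreover have "\<epsilon> < F (st_x S') - F xstar"
      using no[OF accept(3)] y' by (simp add: approx_minimizer_iff upd)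
    moreover have "real (Suc j) \<le> Q * real (2 * Suc t + max 1 (m - 1))"
    proof -
      have "Q * real (2 * t + m + 1) \<le> Q * real (2 * Suc t + max 1 (m - 1))"
        using k by (intro mult_left_mono) auto
      then show ?thesis using trial_done by linarith
    qed
    ultimately show ?thesis
      using k by (intro run_invariant_begin[where t = "Suc t", OF accept(6) S' M']) auto
  qed
qed

text \<open>While the gap exceeds \<epsilon>, \<open>outer_bounds\<close> keeps
  \<open>st_A S * \<epsilon>\<close> below \<open>R0 ^ 4\<close>; since \<open>st_A S\<close> grows
  like \<open>t ^ 4\<close>, this limits \<open>t\<close>. The largest trial value limits
  \<open>m\<close>.\<close>

lemma run_invariant_length:
  assumes eps: "0 < \<epsilon>" "\<epsilon> \<le> 1" and inv: "run_invariant \<epsilon> Q j c"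
  shows "real j \<le> Q * total_trials L M0 R0 * \<epsilon> powr (- 1/4)"
proof -
  from inv obtain S i k t m where S: "outer_invariant S"
    and m: "trial_M S i = 2 ^ m * M0" and Mmax: "trial_M S i \<le> max_trial_M L M0"
    and A: "(growth_const L M0 * real t) ^ 4 \<le> st_A S" and t: "1 \<le> t \<Longrightarrow> \<epsilon> < F (st_x S) - F xstar"
    and k: "real k + 1 \<le> Q" and j: "real j \<le> Q * real (2 * t + m) + real k"
    unfolding run_invariant_def by metis
  define e where "e = \<epsilon> powr (- 1/4)"
  have e1: "e \<ge> 1" unfolding e_def using eps by (simp add: powr_minus powr_le1 one_le_inverse_iff)
  have e4: "e ^ 4 = 1 / \<epsilon>" unfolding e_def using eps by (simp add: powr_power power_divide powr_minus_divide)
  note gc = growth_const(1)[OF M0_pos, of L]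
  have t_le: "real t \<le> R0 / growth_const L M0 * e"
  proof (cases "t = 0")
    case True then show ?thesis using R0_nonneg gc e1 by simp
  next
    case False
    have A0: "st_A S \<ge> 0" using S by (simp add: outer_invariant_def)
    have "st_A S * \<epsilon> \<le> st_A S * (F (st_x S) - F xstar)" using t False A0 by (intro mult_left_mono) auto
    also have "\<dots> \<le> R0 ^ 4 / 4" by (rule outer_bounds(1)[OF S])
    also have "\<dots> \<le> R0 ^ 4" by simp
    finally have "st_A S \<le> R0 ^ 4 / \<epsilon>" using eps by (simp add: pos_le_divide_eq)
    then have "(growth_const L M0 * real t) ^ 4 \<le> (R0 * e) ^ 4"
      using A by (simp add: power_mult_distrib e4)
    then have "growth_const L M0 * real t \<le> R0 * e"
      by (rule power_le_imp_le_base[of _ 3, simplified]) (use R0_nonneg e1 in simp)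
    then show ?thesis using gc by (simp add: pos_le_divide_eq mult.commute)
  qed
  have "2 ^ m \<le> max_trial_M L M0 / M0" using Mmax m M0_pos by (simp add: pos_le_divide_eq)
  then have "log 2 (2 ^ m) \<le> log 2 (max_trial_M L M0 / M0)"
    using M0_pos by (subst log_le_cancel_iff) (auto simp: max_trial_M_def)
  then have m_le: "real m \<le> log 2 (max_trial_M L M0 / M0)" by simp
  have "real j \<le> Q * (real (2 * t + m) + 1)" using j k by (simp add: algebra_simps)
  also have "\<dots> \<le> Q * (2 * (R0 / growth_const L M0 * e) + log 2 (max_trial_M L M0 / M0) * e + 1 * e)"
  proof (intro mult_left_mono)
    have "log 2 (max_trial_M L M0 / M0) * 1 \<le> log 2 (max_trial_M L M0 / M0) * e"
      using e1 m_le by (intro mult_left_mono) auto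
    then show "real (2 * t + m) + 1 \<le> 2 * (R0 / growth_const L M0 * e) + log 2 (max_trial_M L M0 / M0) * e + 1 * e"
      using t_le m_le e1 by simp
  qed (use k in simp)
  also have "\<dots> = Q * total_trials L M0 R0 * e" by (simp add: total_trials_def algebra_simps)
  finally show ?thesis by (simp add: e_def)
qed

lemma run_length_bound:
  assumes eps: "0 < \<epsilon>" "\<epsilon> \<le> 1/2" and run: "algorithm3_run f \<psi> x0 M0 \<epsilon> c out"
  shows "\<exists>N xbar G. out N = Some (xbar, G) \<and> approx_minimizer f \<psi> xstar \<epsilon> xbar G \<and>
    real (N + 1) \<le> (inner_iterations CARD('n) L M0 R0 L\<^sub>\<psi> \<eta> \<kappa> * total_trials L M0 R0 + 1) * \<bar>log (6/5) \<epsilon>\<bar> * \<epsilon> powr (- 1/4)"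
proof -
  define Q where "Q = inner_iterations CARD('n) L M0 R0 L\<^sub>\<psi> \<eta> \<kappa> * \<bar>log (6/5) \<epsilon>\<bar>"
  define hit where "hit = (\<lambda>l. \<exists>x G. out l = Some (x, G) \<and> approx_minimizer f \<psi> xstar \<epsilon> x G)"
  define b where "b = Q * total_trials L M0 R0 * \<epsilon> powr (- 1/4)"
  have "6 \<le> inner_iterations CARD('n) L M0 R0 L\<^sub>\<psi> \<eta> \<kappa>" by (simp add: inner_iterations_def)
  then have "6 * 1 \<le> Q" unfolding Q_def using one_le_abs_log(1)[OF eps] by (intro mult_mono) auto
  then have Q1: "1 \<le> Q" by simp
  have M1: "trial_M (initial_outer x0 M0) (first_i M0 (initial_outer x0 M0)) = 2 ^ 1 * M0"
    using trial_M_first_i[of "initial_outer x0 M0" 0 M0] M0_pos by (simp add: initial_outer_def)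
  have init: "run_invariant \<epsilon> Q 0 (c 0)"
    by (rule run_invariant_begin[where t = 0 and m = 1, OF _ outer_initial M1])
      (use run Q1 M1 in \<open>auto simp: algorithm3_run_def max_trial_M_def initial_outer_def\<close>)
  have "run_invariant \<epsilon> Q j (c j)" if "\<forall>l<j. \<not> hit l" for j
    using that
  proof (induction j)
    case (Suc j)
    have "step f \<psi> M0 \<epsilon> (c j) (out j) (c (Suc j))" using run by (simp add: algorithm3_run_def)
    moreover have "run_invariant \<epsilon> Q j (c j)" using Suc by simp
    moreover have "\<not> hit j" using Suc.prems by simp
    ultimately show ?case
      by (intro run_invariant_step[OF eps Q_def]) (auto simp: hit_def)
  qed (rule init)
  then have len: "real j \<le> b" if "\<forall>l<j. \<not> hit l" for j
    unfolding b_def using eps that by (intro run_invariant_length[where c = "c j"]) auto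
  \<comment> \<open>The first index beyond \<open>b\<close> violates the length bound, so a hit
    occurred earlier.\<close>
  define j where "j = nat \<lfloor>b\<rfloor> + 1"
  have "b < real j" unfolding j_def by linarith
  then have "\<not> (\<forall>l<j. \<not> hit l)" using len[of j] not_le by blast
  then obtain N where N: "N < j" "hit N" by blast
  have b0: "b \<ge> 0" using len[of 0] by simp
  have "real (N + 1) \<le> real j" using N(1) by simp
  also have "\<dots> \<le> b + 1" unfolding j_def using b0 by linarith
  \<comment> \<open>The rounding costs one iteration, absorbed by the \<open>+ 1\<close> in the
    constant.\<close>
  also have "\<dots> \<le> b + \<bar>log (6/5) \<epsilon>\<bar> * \<epsilon> powr (- 1/4)"
  proof -
    have "1 \<le> \<epsilon> powr (- 1/4)" using eps by (simp add: powr_minus powr_le1 one_le_inverse_iff)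
    then have "1 * 1 \<le> \<bar>log (6/5) \<epsilon>\<bar> * \<epsilon> powr (- 1/4)"
      using one_le_abs_log(1)[OF eps] by (intro mult_mono) auto
    then show ?thesis by simp
  qed
  also have "\<dots> = (inner_iterations CARD('n) L M0 R0 L\<^sub>\<psi> \<eta> \<kappa> * total_trials L M0 R0 + 1) * \<bar>log (6/5) \<epsilon>\<bar> * \<epsilon> powr (- 1/4)"
    by (simp add: b_def Q_def algebra_simps)
  finally show ?thesis using N(2) unfolding hit_def by blast
qed

end

theorem mainTheorem6:
  fixes L\<^sub>f M0 R0 L\<^sub>\<psi> \<tau> \<eta> \<kappa> :: real
  assumes "M0 > 0" and "R0 > 0"
  shows "\<exists>C>0. \<exists>\<epsilon>0. 0 < \<epsilon>0 \<and> \<epsilon>0 < 1 \<and>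
    (\<forall>(f :: real^'n \<Rightarrow> real) \<psi> xstar x0.
       convex_on UNIV f \<and> three_times_differentiable f \<and>
       (\<forall>x y. norm (D3 f x - D3 f y) \<le> L\<^sub>f * norm (x - y)) \<and>
       (\<forall>x. \<psi> x \<noteq> -\<infinity>) \<and> econvex \<psi> \<and>
       is_arg_min (composite f \<psi>) (\<lambda>_. True) xstar \<and>
       x0 \<in> edom \<psi> \<and>
       (\<forall>x. composite f \<psi> x \<le> composite f \<psi> x0 \<longrightarrow> norm (x - xstar) \<le> R0) \<and>
       (\<forall>z\<in>edom \<psi>. \<forall>g\<in>subdiff \<psi> z. norm g \<le> L\<^sub>\<psi>) \<and>
       trace (hessian f x0) = \<tau> \<and>
       onorm ((*v) (hessian f x0)) = \<eta> \<and>
       norm (D3 f x0) = \<kappa>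
       \<longrightarrow> (\<forall>\<epsilon> c out. 0 < \<epsilon> \<and> \<epsilon> \<le> \<epsilon>0 \<and> algorithm3_run f \<psi> x0 M0 \<epsilon> c out \<longrightarrow>
             (\<exists>N xbar G. out N = Some (xbar, G) \<and> approx_minimizer f \<psi> xstar \<epsilon> xbar G \<and>
                real (N + 1) \<le> C * \<bar>log 1.2 \<epsilon>\<bar> * \<epsilon> powr (- 1/4))))"
proof -
  define C0 where "C0 = inner_iterations CARD('n) L\<^sub>f M0 R0 L\<^sub>\<psi> \<eta> \<kappa> * total_trials L\<^sub>f M0 R0 + 1"
  \<comment> \<open>The maximum with 1 makes positivity immediate;
    \<open>\<epsilon> \<le> 1/2 < 5/6\<close> keeps the absolute logarithm at least 1.\<close>
  show ?thesis
  proof (rule exI[of _ "max 1 C0"], rule conjI, simp, rule exI[of _ "1/2"], intro conjI allI impI; (elim conjE)?)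
    fix f :: "real^'n \<Rightarrow> real" and \<psi> xstar x0 \<epsilon> c out
    assume asm: "convex_on UNIV f" "three_times_differentiable f"
      "\<forall>x y. norm (D3 f x - D3 f y) \<le> L\<^sub>f * norm (x - y)" "\<forall>x. \<psi> x \<noteq> -\<infinity>" "econvex \<psi>"
      "is_arg_min (composite f \<psi>) (\<lambda>_. True) xstar" "x0 \<in> edom \<psi>"
      "\<forall>x. composite f \<psi> x \<le> composite f \<psi> x0 \<longrightarrow> norm (x - xstar) \<le> R0"
      "\<forall>z\<in>edom \<psi>. \<forall>g\<in>subdiff \<psi> z. norm g \<le> L\<^sub>\<psi>"
      "onorm ((*v) (hessian f x0)) = \<eta>" "norm (D3 f x0) = \<kappa>"
    assume run: "0 < \<epsilon>" "\<epsilon> \<le> 1/2" "algorithm3_run f \<psi> x0 M0 \<epsilon> c out"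
    interpret accelerated f L\<^sub>f \<psi> xstar x0 M0 R0 L\<^sub>\<psi> \<eta> \<kappa>
      by unfold_locales (use asm assms in \<open>auto simp: subdiff_def\<close>)
    from run_length_bound[OF run] obtain N xbar G where N: "out N = Some (xbar, G)"
      "approx_minimizer f \<psi> xstar \<epsilon> xbar G" "real (N + 1) \<le> C0 * \<bar>log (6/5) \<epsilon>\<bar> * \<epsilon> powr (- 1/4)"
      unfolding C0_def by blast
    have "C0 * (\<bar>log (6/5) \<epsilon>\<bar> * \<epsilon> powr (- 1/4)) \<le> max 1 C0 * (\<bar>log (6/5) \<epsilon>\<bar> * \<epsilon> powr (- 1/4))"
      by (intro mult_right_mono) auto
    moreover have "(1.2::real) = 6/5" by simp
    ultimately have "real (N + 1) \<le> max 1 C0 * \<bar>log 1.2 \<epsilon>\<bar> * \<epsilon> powr (- 1/4)"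
      using N(3) by (simp add: mult.assoc)
    then show "\<exists>N xbar G. out N = Some (xbar, G) \<and> approx_minimizer f \<psi> xstar \<epsilon> xbar G \<and>
        real (N + 1) \<le> max 1 C0 * \<bar>log 1.2 \<epsilon>\<bar> * \<epsilon> powr (- 1/4)"
      using N by blast
  qed auto
qed

end
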